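(* Let $K$ be a field, let $d\ge 1$ be an integer, and let $I$ be a nonzero homogeneous ideal of $R = K[x_1,\ldots,x_n]$ (standard graded) with a $d$-linear resolution. If $$\beta(I) = \sum_{j=0}^{t}\alpha_j\, j!\cdot\pi(d,d+1,\ldots,d+j),$$ where $\alpha_0,\ldots,\alpha_t$ are rational numbers and $t\le n$, then, setting $\alpha_{t+1}=0$, $$\beta(R/I) = \sum_{j=0}^{t}\Big((d+j)\alpha_j-(j+1)\alpha_{j+1}\Big)\, j!\cdot\pi(0,d,d+1,\ldots,d+j).$$
   Context: For a finitely generated graded $R$-module $M$ with minimal graded free resolution $0\to F_n\to\cdots\to F_0\to M\to 0$, $F_i = \bigoplus_{j\in\mathbb{Z}} R(-j)^{\beta_{i,j}(M)}$, the Betti table of $M$ is $\beta(M) = (\beta_{i,j}(M))_{i,j}$ (here $i$ is the homological degree and $j$ the internal degree). $M$ has a $d$-linear resolution if $\beta_{i,j}(M)=0$ for all $0\le i\le n$ and all $j\ne i+d$. For an increasing sequence of integers $\mathbf{d} = (d_0,\ldots,d_s)$, the pure diagram $\pi(\mathbf{d})=\pi(d_0,\ldots,d_s)$ is the table with entries $$\pi(\mathbf{d})_{i,j} = (-1)^i\prod_{k=0,\,k\ne i}^{s}\frac{1}{d_k-d_i}\ \text{ if } 0\le i\le s \text{ and } j=d_i,\qquad \pi(\mathbf{d})_{i,j}=0 \text{ otherwise.}$$ *)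

theory Defs
  imports "HOL-Library.Poly_Mapping" "HOL-Library.Cardinality" "HOL-Algebra.Algebraic_Closure_Type"
begin

text \<open>
  The polynomial ring \<open>R = K[x\<^sub>1, \<dots>, x\<^sub>n]\<close> with \<open>n = CARD('n)\<close> is the type of finitely supported
  maps from exponent vectors to coefficients, whose multiplication is convolution.
  It is turned into a HOL-Algebra ring with carrier \<open>UNIV\<close> by \<^const>\<open>ring_of_type_algebra\<close>.
\<close>

type_synonym ('n, 'k) mpoly = "('n \<Rightarrow>\<^sub>0 nat) \<Rightarrow>\<^sub>0 'k"

abbreviation mpoly_ring :: "('n::finite, 'k::field) mpoly ring" where
  "mpoly_ring \<equiv> ring_of_type_algebra"

definition homogeneous_part :: "int \<Rightarrow> ('n::finite, 'k::field) mpoly set" where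
  "homogeneous_part e = {p. \<forall>m\<in>Poly_Mapping.keys p. int (\<Sum>i\<in>UNIV. Poly_Mapping.lookup m i) = e}"

definition homogeneous_ideal :: "('n::finite, 'k::field) mpoly set \<Rightarrow> bool" where
  "homogeneous_ideal I \<longleftrightarrow> (\<exists>S \<subseteq> (\<Union>e. homogeneous_part e). I = genideal mpoly_ring S)"


text \<open>
  A graded module is a HOL-Algebra module together with its graded pieces
  \<open>M\<^sub>e = grade M e\<close>.  The module record of HOL-Algebra extends the ring record, so it
  has fields for a multiplication and a unit; these play no role here.
\<close>

record ('r, 'm) gmodule = "('r, 'm) module" +
  grade :: "int \<Rightarrow> 'm set"

definition ideal_gmodule ::
    "('n::finite, 'k::field) mpoly set \<Rightarrow> (('n, 'k) mpoly, ('n, 'k) mpoly) gmodule" where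
  "ideal_gmodule I =
    \<lparr>carrier = I, monoid.mult = (*), one = 1, zero = 0, add = (+), module.smult = (*),
     grade = (\<lambda>e. I \<inter> homogeneous_part e)\<rparr>"

definition quotient_gmodule ::
    "('n::finite, 'k::field) mpoly set \<Rightarrow> (('n, 'k) mpoly, ('n, 'k) mpoly set) gmodule" where
  "quotient_gmodule I = (let Q = mpoly_ring Quot I; cls = (\<lambda>p. I +>\<^bsub>mpoly_ring\<^esub> p) in
    \<lparr>carrier = carrier Q, monoid.mult = monoid.mult Q, one = one Q, zero = zero Q, add = add Q,
     module.smult = (\<lambda>r C. cls r \<otimes>\<^bsub>Q\<^esub> C),
     grade = (\<lambda>e. cls ` homogeneous_part e)\<rparr>)"

text \<open>
  The graded free module \<open>\<Oplus>\<^sub>j R(-j)\<^bsup>b j\<^esup>\<close>.  Its standard basis is indexed by the pairs \<open>(j, k)\<close>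
  with \<open>k < b j\<close>, and since \<open>R(-j)\<^sub>e = R\<^bsub>e - j\<^esub>\<close> the basis element \<open>(j, k)\<close> has degree \<open>j\<close>.
\<close>

definition free_gmodule ::
    "(int \<Rightarrow> nat) \<Rightarrow> (('n::finite, 'k::field) mpoly, (int \<times> nat) \<Rightarrow>\<^sub>0 ('n, 'k) mpoly) gmodule" where
  "free_gmodule b = (let F = {v. Poly_Mapping.keys v \<subseteq> {(j, k). k < b j}} in
    \<lparr>carrier = F, monoid.mult = (\<lambda>_ _. 0), one = 0, zero = 0, add = (+),
     module.smult = (\<lambda>r. Poly_Mapping.map ((*) r)),
     grade = (\<lambda>e. {v \<in> F. \<forall>j k. Poly_Mapping.lookup v (j, k) \<in> homogeneous_part (e - j)})\<rparr>)"

definition graded_hom ::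
    "(('n::finite, 'k::field) mpoly, 'a) gmodule \<Rightarrow> (('n, 'k) mpoly, 'b) gmodule \<Rightarrow>
      ('a \<Rightarrow> 'b) set" where
  "graded_hom M N = {f.
     f \<in> carrier M \<rightarrow> carrier N \<and>
     (\<forall>x\<in>carrier M. \<forall>y\<in>carrier M. f (x \<oplus>\<^bsub>M\<^esub> y) = f x \<oplus>\<^bsub>N\<^esub> f y) \<and>
     (\<forall>r. \<forall>x\<in>carrier M. f (r \<odot>\<^bsub>M\<^esub> x) = r \<odot>\<^bsub>N\<^esub> f x) \<and>
     (\<forall>e. f ` grade M e \<subseteq> grade N e)}"

text \<open>
  \<open>minimal_graded_free_resolution M b \<epsilon> \<delta>\<close> says that
  \<open>\<cdots> \<rightarrow> F\<^sub>2 \<rightarrow> F\<^sub>1 \<rightarrow> F\<^sub>0 \<rightarrow> M \<rightarrow> 0\<close> is a minimal graded free resolution of \<open>M\<close>, where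
  \<open>F\<^sub>i = \<Oplus>\<^sub>j R(-j)\<^bsup>b i j\<^esup>\<close>, the augmentation is \<open>\<epsilon>\<close> and the differentials are
  \<open>\<delta> i : F\<^bsub>i+1\<^esub> \<rightarrow> F\<^sub>i\<close>.  Minimality means \<open>\<delta> i (F\<^bsub>i+1\<^esub>) \<subseteq> \<mm> F\<^sub>i\<close>, where the ideal
  \<open>\<mm> = (x\<^sub>1, \<dots>, x\<^sub>n)\<close> consists of the polynomials with constant coefficient \<open>0\<close>.

  Finite rank of the \<open>F\<^sub>i\<close> and \<open>F\<^sub>i = 0\<close> for \<open>i > n\<close> are not imposed: for finitely generated
  \<open>M\<close> they hold by Hilbert's basis theorem and Hilbert's syzygy theorem.
\<close>

definition minimal_graded_free_resolution ::
    "(('n::finite, 'k::field) mpoly, 'm) gmodule \<Rightarrow> (nat \<Rightarrow> int \<Rightarrow> nat) \<Rightarrow>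
      (((int \<times> nat) \<Rightarrow>\<^sub>0 ('n, 'k) mpoly) \<Rightarrow> 'm) \<Rightarrow>
      (nat \<Rightarrow> ((int \<times> nat) \<Rightarrow>\<^sub>0 ('n, 'k) mpoly) \<Rightarrow> ((int \<times> nat) \<Rightarrow>\<^sub>0 ('n, 'k) mpoly)) \<Rightarrow> bool" where
  "minimal_graded_free_resolution M b \<epsilon> \<delta> \<longleftrightarrow>
     \<epsilon> \<in> graded_hom (free_gmodule (b 0)) M \<and>
     (\<forall>i. \<delta> i \<in> graded_hom (free_gmodule (b (Suc i))) (free_gmodule (b i))) \<and>
     \<epsilon> ` carrier (free_gmodule (b 0)) = carrier M \<and>
     \<delta> 0 ` carrier (free_gmodule (b 1)) = {v \<in> carrier (free_gmodule (b 0)). \<epsilon> v = \<zero>\<^bsub>M\<^esub>} \<and>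
     (\<forall>i. \<delta> (Suc i) ` carrier (free_gmodule (b (Suc (Suc i)))) =
       {v \<in> carrier (free_gmodule (b (Suc i))). \<delta> i v = 0}) \<and>
     (\<forall>i. \<forall>v\<in>carrier (free_gmodule (b (Suc i))). \<forall>g.
       Poly_Mapping.lookup (Poly_Mapping.lookup (\<delta> i v) g) 0 = 0)"

text \<open>
  Minimal graded free resolutions of a finitely generated graded module exist and are unique up to
  isomorphism, so their common table of ranks is well defined.
\<close>

definition betti :: "(('n::finite, 'k::field) mpoly, 'm) gmodule \<Rightarrow> nat \<Rightarrow> int \<Rightarrow> nat" where
  "betti M = (THE b. \<exists>\<epsilon> \<delta>. minimal_graded_free_resolution M b \<epsilon> \<delta>)"

definition has_linear_resolution ::
    "(('n::finite, 'k::field) mpoly, 'm) gmodule \<Rightarrow> int \<Rightarrow> bool" where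
  "has_linear_resolution M d \<longleftrightarrow> (\<forall>i \<le> CARD('n). \<forall>j. j \<noteq> int i + d \<longrightarrow> betti M i j = 0)"


text \<open>\<open>pure_diagram [d\<^sub>0, \<dots>, d\<^sub>s]\<close> is \<open>\<pi>(d\<^sub>0, \<dots>, d\<^sub>s)\<close>; it is meant for strictly increasing lists.\<close>

definition pure_diagram :: "int list \<Rightarrow> nat \<Rightarrow> int \<Rightarrow> rat" where
  "pure_diagram ds i j =
    (if i < length ds \<and> j = ds ! i
     then (-1) ^ i * (\<Prod>k\<in>{..<length ds} - {i}. 1 / of_int (ds ! k - ds ! i))
     else 0)"

end

theory Submission
  imports Defs
begin

text \<open>
  Splicing a minimal resolution of \<open>I\<close> with \<open>R \<rightarrow> R/I\<close> shows \<open>\<beta>\<^bsub>i+1\<^esub>(R/I) = \<beta>\<^sub>i(I)\<close>, once minimal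
  resolutions are known to exist and to have unique ranks; a linear resolution with \<open>d \<ge> 1\<close> puts \<open>I\<close>
  inside the maximal ideal, so the spliced complex is again minimal. Since
  \<open>l! \<cdot> \<pi>(d, \<dots>, d + l)\<^sub>i = binom(l, i)\<close> and
  \<open>l! \<cdot> \<pi>(0, d, \<dots>, d + l)\<^bsub>i+1\<^esub> = binom(l, i) / (d + i)\<close>, the claim in homological degrees \<open>i + 1\<close> is
  summation by parts. In homological degree \<open>0\<close> the right-hand side telescopes to \<open>\<alpha>\<^sub>0\<close>, which equals
  \<open>\<Sum>\<^sub>i (-1)\<^sup>i \<beta>\<^sub>i(I)\<close>, the rank of \<open>I\<close>, hence \<open>1\<close>.
\<close>

section \<open>Graded free modules over the polynomial ring\<close>

text \<open>The \<open>THE\<close> in the definition of \<open>betti\<close> says nothing until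
  existence and uniqueness are proved, and the resolutions over which it ranges may a priori be
  infinite in length and in rank. Both proofs therefore work one internal degree at a time.
  Generators of nonnegative degree, finitely many in each degree, leave every graded piece
  finite-dimensional over \<open>K\<close>, which is enough for the construction; uniqueness
  compares the ranks in each bidegree by linear algebra over \<open>K\<close>. That the resolution
  has finite length is read off from the given formula, since \<open>binom(l, i)\<close> vanishes
  for \<open>i > t \<ge> l\<close>. The rank of \<open>I\<close> enters as the limit of the quotient
  of the Hilbert functions of \<open>I\<close> and \<open>R\<close>, so that only dimensions of
  graded pieces have to be computed.\<close>

abbreviation "lookup \<equiv> Poly_Mapping.lookup"
abbreviation "keys \<equiv> Poly_Mapping.keys"
abbreviation "single \<equiv> Poly_Mapping.single"

section \<open>Finitely supported families over a commutative ring and their linear maps\<close>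

abbreviation pscale :: "'r::comm_ring_1 \<Rightarrow> ('a \<Rightarrow>\<^sub>0 'r) \<Rightarrow> ('a \<Rightarrow>\<^sub>0 'r)" where
  "pscale r \<equiv> Poly_Mapping.map ((*) r)"

text \<open>Generators are pairs \<open>(j, k)\<close>; a quantifier over them is kept as a
  quantifier over one variable \<open>g\<close>.\<close>

declare split_paired_All [simp del] split_paired_Ex [simp del]

lemma lookup_pscale [simp]: "lookup (pscale r v) g = r * lookup v g"
  by (simp add: map.rep_eq when_def)

interpretation pm: Modules.module "pscale :: 'r::comm_ring_1 \<Rightarrow> ('a \<Rightarrow>\<^sub>0 'r) \<Rightarrow> _"
  by unfold_locales (auto intro!: poly_mapping_eqI simp: lookup_add algebra_simps)

lemma keys_pscale: "keys (pscale r v) \<subseteq> keys v"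
  by (auto simp: in_keys_iff)

lemma pscale_single [simp]: "pscale r (single g c) = single g (r * c)"
  by (auto intro!: poly_mapping_eqI simp: lookup_single when_def)

lemma poly_mapping_eq_sum_single:
  "v = (\<Sum>g\<in>keys v. single g (lookup v g))"
  by (rule poly_mapping_eqI) (simp add: lookup_sum lookup_single when_def sum.delta' in_keys_iff)

text \<open>Maps out of a free module are additive only on its carrier, so the induction never
  leaves the families supported in \<open>G\<close>.\<close>

lemma poly_mapping_keys_induct [consumes 1, case_names zero add single]:
  fixes v :: "'a \<Rightarrow>\<^sub>0 'b::comm_monoid_add"
  assumes "keys v \<subseteq> G"
    and zero: "P 0"
    and add: "\<And>v w. keys v \<subseteq> G \<Longrightarrow> keys w \<subseteq> G \<Longrightarrow> P v \<Longrightarrow> P w \<Longrightarrow> P (v + w)"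
    and single: "\<And>g c. g \<in> G \<Longrightarrow> P (single g c)"
  shows "P v"
proof -
  have "keys (\<Sum>g\<in>A. single g (lookup v g)) \<subseteq> G
      \<and> P (\<Sum>g\<in>A. single g (lookup v g))"
    if "finite A" "A \<subseteq> G" for A
    using that
  proof (induction A rule: finite_induct)
    case empty
    then show ?case by (simp add: zero)
  next
    case (insert x F)
    have "keys (single x (lookup v x)) \<subseteq> G"
      using insert by auto
    then show ?case using insert
      by (auto intro!: add single simp: dest!: subsetD[OF Poly_Mapping.keys_add])
  qed
  from this[of "keys v"] assms(1) show ?thesis
    by (metis finite_keys poly_mapping_eq_sum_single)
qed

text \<open>The map with columns \<open>\<phi>\<close>, taken on all finitely supported families
  instead of one free module; linearity then holds without carrier conditions.\<close>

definition lin :: "('a \<Rightarrow> ('b \<Rightarrow>\<^sub>0 'r::comm_ring_1)) \<Rightarrow> ('a \<Rightarrow>\<^sub>0 'r) \<Rightarrow> ('b \<Rightarrow>\<^sub>0 'r)" where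
  "lin \<phi> v = (\<Sum>g\<in>keys v. pscale (lookup v g) (\<phi> g))"

lemma lin_superset:
  assumes "finite A" "keys v \<subseteq> A"
  shows "lin \<phi> v = (\<Sum>g\<in>A. pscale (lookup v g) (\<phi> g))"
  unfolding lin_def using assms
  by (intro sum.mono_neutral_left) (auto simp: in_keys_iff)

lemma lin_single [simp]: "lin \<phi> (single g r) = pscale r (\<phi> g)"
  by (simp add: lin_def)

lemma lin_module_hom:
  fixes \<phi> :: "'a \<Rightarrow> ('b \<Rightarrow>\<^sub>0 'r::comm_ring_1)"
  shows "module_hom pscale pscale (lin \<phi>)"
proof
  fix v w :: "'a \<Rightarrow>\<^sub>0 'r" and r
  let ?A = "keys v \<union> keys w"
  have s: "keys (v + w) \<subseteq> ?A" "keys v \<subseteq> ?A" "keys w \<subseteq> ?A"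
    using Poly_Mapping.keys_add[of v w] by auto
  show "lin \<phi> (v + w) = lin \<phi> v + lin \<phi> w"
    by (simp add: lin_superset[OF _ s(1)] lin_superset[OF _ s(2)] lin_superset[OF _ s(3)]
        lookup_add pm.scale_left_distrib sum.distrib)
  show "lin \<phi> (pscale r v) = pscale r (lin \<phi> v)"
    by (subst lin_superset[OF finite_keys keys_pscale]) (simp add: lin_def pm.scale_sum_right)
qed

lemmas lin_add = module_hom.add[OF lin_module_hom]
  and lin_pscale = module_hom.scale[OF lin_module_hom]
  and lin_zero [simp] = module_hom.zero[OF lin_module_hom]
  and lin_diff = module_hom.diff[OF lin_module_hom]
  and lin_sum = module_hom.sum[OF lin_module_hom]

lemma lookup_lin: "lookup (lin \<phi> v) h = (\<Sum>g\<in>keys v. lookup v g * lookup (\<phi> g) h)"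
  by (simp add: lin_def lookup_sum)

lemma lin_lin: "lin \<psi> (lin \<phi> v) = lin (\<lambda>g. lin \<psi> (\<phi> g)) v"
  by (simp add: lin_def[of \<phi> v] lin_def[of "\<lambda>g. lin \<psi> (\<phi> g)" v] lin_sum lin_pscale)

lemma lin_cong: "(\<And>g. g \<in> keys v \<Longrightarrow> \<phi> g = \<psi> g) \<Longrightarrow> lin \<phi> v = lin \<psi> v"
  by (simp add: lin_def)

lemma lin_basis: "lin (\<lambda>g. single g 1) v = v"
  by (simp add: lin_def poly_mapping_eq_sum_single[of v, symmetric])

lemma lin_minus_fun: "lin (\<lambda>g. \<phi> g - \<psi> g) v = lin \<phi> v - lin \<psi> v"
  by (simp add: lin_def pm.scale_right_diff_distrib sum_subtractf)

lemma additive_eq_lin: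
  fixes v :: "'a \<Rightarrow>\<^sub>0 'r::comm_ring_1"
  assumes "keys v \<subseteq> G"
    and "\<And>v w. keys v \<subseteq> G \<Longrightarrow> keys w \<subseteq> G \<Longrightarrow> f (v + w) = f v + f w"
    and "\<And>r v. keys v \<subseteq> G \<Longrightarrow> f (pscale r v) = pscale r (f v)"
  shows "f v = lin (\<lambda>g. f (single g 1)) v"
  using assms(1)
proof (induction rule: poly_mapping_keys_induct)
  case zero
  have "f (0 + 0) = f 0 + f 0" by (rule assms(2)) auto
  then show ?case by simp
next
  case (add v w)
  then show ?case by (simp add: assms(2) lin_add)
next
  case (single g c)
  have "f (pscale c (single g 1)) = pscale c (f (single g 1))"
    using single by (intro assms(3)) auto
  then show ?case by simp
qed

section \<open>The standard grading of the polynomial ring\<close>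

definition mdeg :: "('n::finite \<Rightarrow>\<^sub>0 nat) \<Rightarrow> nat" where
  "mdeg m = (\<Sum>i\<in>UNIV. lookup m i)"

lemma mdeg_0 [simp]: "mdeg 0 = 0" by (simp add: mdeg_def)

lemma mdeg_eq_0_iff [simp]: "mdeg m = 0 \<longleftrightarrow> m = 0"
  by (auto simp: mdeg_def intro!: poly_mapping_eqI)

lemma mdeg_add [simp]: "mdeg (m + m') = mdeg m + mdeg m'"
  by (simp add: mdeg_def lookup_add sum.distrib)

lemma homogeneous_part_iff:
  "p \<in> homogeneous_part e \<longleftrightarrow> (\<forall>m. lookup p m \<noteq> 0 \<longrightarrow> int (mdeg m) = e)"
  by (auto simp: homogeneous_part_def mdeg_def in_keys_iff)

lemma homogeneous_part_zero [simp]: "0 \<in> homogeneous_part e"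
  by (simp add: homogeneous_part_iff)

lemma homogeneous_part_add:
  "p \<in> homogeneous_part e \<Longrightarrow> q \<in> homogeneous_part e \<Longrightarrow> p + q \<in> homogeneous_part e"
  unfolding homogeneous_part_iff by (metis add.right_neutral lookup_add)

lemma homogeneous_part_mult:
  assumes "p \<in> homogeneous_part e" "q \<in> homogeneous_part e'"
  shows "p * q \<in> homogeneous_part (e + e')"
  using assms keys_mult[of p q] unfolding homogeneous_part_iff in_keys_iff[symmetric] by fastforce

lemma homogeneous_part_single:
  "single m c \<in> homogeneous_part e \<longleftrightarrow> c = 0 \<or> int (mdeg m) = e"
  by (auto simp: homogeneous_part_iff lookup_single when_def)

lemma homogeneous_part_1: "1 \<in> homogeneous_part 0"
  unfolding single_one[symmetric] homogeneous_part_single by simp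

lemma homogeneous_part_uminus: "p \<in> homogeneous_part e \<Longrightarrow> - p \<in> homogeneous_part e"
  by (simp add: homogeneous_part_iff)

text \<open>Exponent vectors are nonnegative, so two of them add up to 0 only if both are 0. Hence
  the constant coefficient is multiplicative: it is the reduction modulo the maximal ideal.\<close>

lemma lookup_mult_0:
  fixes p q :: "('n::finite, 'k::field) mpoly"
  shows "lookup (p * q) 0 = lookup p 0 * lookup q 0"
proof -
  have s: "a + b = (0 :: 'n \<Rightarrow>\<^sub>0 nat) \<longleftrightarrow> a = 0 \<and> b = 0" for a b
    by (metis mdeg_add mdeg_eq_0_iff add_is_0)
  have "lookup (p * q) 0 = (\<Sum>a. lookup p a * (\<Sum>b. (lookup q b when b = 0) when a = 0))"
    unfolding lookup_mult
    by (intro arg_cong[where f = Sum_any] ext)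
       (auto simp: s when_def eq_commute[of "0::'n \<Rightarrow>\<^sub>0 nat"] 
         intro!: arg_cong[where f = "(*) _"] arg_cong[where f = Sum_any])
  also have "\<dots> = (\<Sum>a. lookup p a * lookup q 0 when a = 0)"
    by (intro arg_cong[where f = Sum_any] ext) (auto simp: when_def)
  also have "\<dots> = lookup p 0 * lookup q 0"
    by simp
  finally show ?thesis .
qed

definition hpart :: "int \<Rightarrow> ('n::finite, 'k::field) mpoly \<Rightarrow> ('n, 'k) mpoly" where
  "hpart e = Poly_Mapping.mapp (\<lambda>m c. c when int (mdeg m) = e)"

lemma lookup_hpart [simp]: "lookup (hpart e p) m = (lookup p m when int (mdeg m) = e)"
  by (auto simp: hpart_def lookup_mapp when_def in_keys_iff)

lemma hpart_in: "hpart e p \<in> homogeneous_part e"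
  by (simp add: homogeneous_part_iff when_def)

lemma hpart_zero [simp]: "hpart e 0 = 0"
  by (rule poly_mapping_eqI) simp

lemma hpart_add: "hpart e (p + q) = hpart e p + hpart e q"
  by (rule poly_mapping_eqI) (simp add: lookup_add when_def)

lemma hpart_sum: "hpart e (sum f A) = (\<Sum>x\<in>A. hpart e (f x))"
  by (induction A rule: infinite_finite_induct) (auto simp: hpart_add)

lemma hpart_id: "p \<in> homogeneous_part e \<Longrightarrow> hpart e p = p"
  by (rule poly_mapping_eqI) (auto simp: homogeneous_part_iff when_def)

lemma hpart_mult:
  assumes "q \<in> homogeneous_part k"
  shows "hpart e (p * q) = hpart (e - k) p * q"
proof -
  \<comment> \<open>\<open>s\<close> collects the components of \<open>p\<close> of degree other
    than \<open>e - k\<close>; multiplied by a form of degree \<open>k\<close> they cannot reach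
    degree \<open>e\<close>.\<close>
  define s where "s = p - hpart (e - k) p"
  have s: "int (mdeg m) \<noteq> e - k" if "lookup s m \<noteq> 0" for m
    using that by (auto simp: s_def lookup_minus when_def split: if_splits)
  have "hpart e (s * q) = 0"
  proof (rule poly_mapping_eqI, rule ccontr)
    fix m assume *: "lookup (hpart e (s * q)) m \<noteq> lookup 0 m"
    then have "m \<in> keys (s * q)" "int (mdeg m) = e"
      by (auto simp: when_def in_keys_iff split: if_splits)
    then obtain a b where "m = a + b" "lookup s a \<noteq> 0" "lookup q b \<noteq> 0"
      using keys_mult[of s q] by (auto simp: in_keys_iff)
    with s[of a] assms \<open>int (mdeg m) = e\<close> show False
      by (auto simp: homogeneous_part_iff)
  qed
  moreover have "hpart (e - k) p * q \<in> homogeneous_part e"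
    using homogeneous_part_mult[OF hpart_in assms, of "e - k" p] by simp
  moreover have "p * q = s * q + hpart (e - k) p * q"
    by (simp add: s_def algebra_simps)
  ultimately show ?thesis by (simp add: hpart_add hpart_id)
qed

section \<open>Graded free modules with shifted generators\<close>

type_synonym ('n, 'k) fmod = "(int \<times> nat) \<Rightarrow>\<^sub>0 ('n, 'k) mpoly"

definition gens :: "(int \<Rightarrow> nat) \<Rightarrow> (int \<times> nat) set" where
  "gens b = {(j, k). k < b j}"

definition fcar :: "(int \<Rightarrow> nat) \<Rightarrow> ('n::finite, 'k::field) fmod set" where
  "fcar b = {v. keys v \<subseteq> gens b}"

text \<open>No rank function enters: one grading serves all free modules, and the graded piece of
  one of them is its intersection with \<open>fcar b\<close>.\<close>

definition fdeg :: "int \<Rightarrow> ('n::finite, 'k::field) fmod set" where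
  "fdeg e = {v. \<forall>g. lookup v g \<in> homogeneous_part (e - fst g)}"

lemma carrier_free_gmodule: "carrier (free_gmodule b) = fcar b"
  by (simp add: free_gmodule_def fcar_def gens_def Let_def)

lemma grade_free_gmodule: "grade (free_gmodule b) e = fcar b \<inter> fdeg e"
  by (auto simp: split_paired_All free_gmodule_def fcar_def gens_def fdeg_def Let_def)

lemma free_gmodule_simps [simp]:
  "add (free_gmodule b) = (+)" "module.smult (free_gmodule b) = pscale" "zero (free_gmodule b) = 0"
  by (simp_all add: free_gmodule_def Let_def)

lemma fcar_subspace: "pm.subspace (fcar b)"
  unfolding pm.subspace_def fcar_def
  by (auto dest!: subsetD[OF keys_pscale] subsetD[OF Poly_Mapping.keys_add])

lemmas fcar_zero [simp] = pm.subspace_0[OF fcar_subspace]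
  and fcar_add = pm.subspace_add[OF fcar_subspace]
  and fcar_pscale = pm.subspace_scale[OF fcar_subspace]
  and fcar_diff = pm.subspace_diff[OF fcar_subspace]
  and fcar_sum = pm.subspace_sum[OF fcar_subspace]

lemma fcar_single: "g \<in> gens b \<Longrightarrow> single g r \<in> fcar b"
  by (auto simp: fcar_def)

lemma fdeg_zero [simp]: "0 \<in> fdeg e" by (simp add: fdeg_def)

lemma fdeg_add: "v \<in> fdeg e \<Longrightarrow> w \<in> fdeg e \<Longrightarrow> v + w \<in> fdeg e"
  by (simp add: fdeg_def lookup_add homogeneous_part_add)

lemma fdeg_pscale: "r \<in> homogeneous_part k \<Longrightarrow> v \<in> fdeg e \<Longrightarrow> pscale r v \<in> fdeg (k + e)"
  by (simp add: fdeg_def) (metis add_diff_eq homogeneous_part_mult)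

lemma fdeg_sum: "(\<And>x. x \<in> A \<Longrightarrow> f x \<in> fdeg e) \<Longrightarrow> sum f A \<in> fdeg e"
  by (induction A rule: infinite_finite_induct) (auto intro: fdeg_add)

lemma fdeg_single:
  "r \<in> homogeneous_part (e - fst g) \<Longrightarrow> single g r \<in> fdeg e"
  by (auto simp: fdeg_def lookup_single when_def)

lemma fdeg_basis: "single g 1 \<in> fdeg (fst g)"
  by (rule fdeg_single) (simp add: homogeneous_part_1)

text \<open>A nonzero constant in coordinate \<open>g\<close> sits in degree \<open>fst g\<close>
  because of the shift. Modulo the maximal ideal, degree preserving matrices thus become block
  diagonal, with one block per internal degree.\<close>

lemma fdeg_lookup_0: "v \<in> fdeg e \<Longrightarrow> lookup (lookup v g) 0 \<noteq> 0 \<Longrightarrow> fst g = e"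
  unfolding fdeg_def homogeneous_part_iff mem_Collect_eq by (metis eq_iff_diff_eq_0 mdeg_0 of_nat_0)

definition fpart :: "int \<Rightarrow> ('n::finite, 'k::field) fmod \<Rightarrow> ('n, 'k) fmod" where
  "fpart e = Poly_Mapping.mapp (\<lambda>g. hpart (e - fst g))"

lemma lookup_fpart [simp]: "lookup (fpart e v) g = hpart (e - fst g) (lookup v g)"
  by (auto simp: fpart_def lookup_mapp when_def in_keys_iff)

lemma fpart_fdeg: "fpart e v \<in> fdeg e"
  by (simp add: fdeg_def hpart_in)

lemma fpart_fcar: "v \<in> fcar b \<Longrightarrow> fpart e v \<in> fcar b"
  by (auto simp: fcar_def subset_iff in_keys_iff) (metis hpart_zero)

lemma fpart_id: "v \<in> fdeg e \<Longrightarrow> fpart e v = v"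
  by (rule poly_mapping_eqI) (simp add: fdeg_def hpart_id)

lemma fpart_zero [simp]: "fpart e 0 = 0"
  by (rule poly_mapping_eqI) simp

lemma fpart_add: "fpart e (v + w) = fpart e v + fpart e w"
  by (rule poly_mapping_eqI) (simp add: lookup_add hpart_add)

lemma fpart_sum: "fpart e (sum f A) = (\<Sum>x\<in>A. fpart e (f x))"
  by (induction A rule: infinite_finite_induct) (auto simp: fpart_add)

lemma fpart_pscale: "v \<in> fdeg k \<Longrightarrow> fpart e (pscale r v) = pscale (hpart (e - k) r) v"
  unfolding fdeg_def
proof (rule poly_mapping_eqI)
  fix g assume "v \<in> {v. \<forall>g. lookup v g \<in> homogeneous_part (k - fst g)}"
  then have "hpart (e - fst g) (r * lookup v g) = hpart (e - fst g - (k - fst g)) r * lookup v g"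
    by (intro hpart_mult) simp
  then show "lookup (fpart e (pscale r v)) g = lookup (pscale (hpart (e - k) r) v) g"
    by simp
qed

text \<open>
  The columns of a degree preserving map into \<open>free_gmodule c\<close>. All pairs \<open>g\<close> are constrained, not only
  the generators of a source module, so that \<open>lin \<phi>\<close> is total and always lands in \<open>fcar c\<close>.
\<close>

definition graded_matrix :: "(int \<Rightarrow> nat) \<Rightarrow> (int \<times> nat \<Rightarrow> ('n::finite, 'k::field) fmod) \<Rightarrow> bool" where
  "graded_matrix c \<phi> \<longleftrightarrow> (\<forall>g. \<phi> g \<in> fcar c \<inter> fdeg (fst g))"

lemma lin_fcar: "graded_matrix c \<phi> \<Longrightarrow> lin \<phi> v \<in> fcar c"
  by (auto simp: lin_def graded_matrix_def intro!: fcar_sum fcar_pscale)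

lemma lin_fdeg: "graded_matrix c \<phi> \<Longrightarrow> v \<in> fdeg e \<Longrightarrow> lin \<phi> v \<in> fdeg e"
  unfolding lin_def
proof (rule fdeg_sum)
  fix g assume "graded_matrix c \<phi>" "v \<in> fdeg e"
  then have "pscale (lookup v g) (\<phi> g) \<in> fdeg ((e - fst g) + fst g)"
    by (intro fdeg_pscale) (auto simp: graded_matrix_def fdeg_def)
  then show "pscale (lookup v g) (\<phi> g) \<in> fdeg e" by simp
qed

text \<open>Lets a preimage or a kernel element be replaced by its component of the right
  degree.\<close>

lemma fpart_lin:
  assumes "graded_matrix c \<phi>"
  shows "fpart e (lin \<phi> v) = lin \<phi> (fpart e v)"
proof -
  have k: "keys (fpart e v) \<subseteq> keys v"
    by (auto simp: in_keys_iff)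
  have d: "\<phi> g \<in> fdeg (fst g)" for g using assms by (simp add: graded_matrix_def)
  have "fpart e (lin \<phi> v) = (\<Sum>g\<in>keys v. pscale (hpart (e - fst g) (lookup v g)) (\<phi> g))"
    by (simp add: lin_def fpart_sum fpart_pscale[OF d])
  also have "\<dots> = lin \<phi> (fpart e v)"
    by (simp add: lin_superset[OF _ k])
  finally show ?thesis .
qed

lemma graded_hom_eq_lin:
  assumes "f \<in> graded_hom (free_gmodule b) (free_gmodule c)"
  shows "\<exists>\<phi>. graded_matrix c \<phi> \<and> (\<forall>v\<in>fcar b. f v = lin \<phi> v)"
proof -
  \<comment> \<open>Off the generators the column is 0, which lies in \<open>fcar c\<close> and is
    homogeneous of every degree, as \<open>graded_matrix\<close> requires of all pairs.\<close>
  define \<phi> where "\<phi> g = (if g \<in> gens b then f (single g 1) else 0)" for g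
  from assms have f: "\<And>v w. v \<in> fcar b \<Longrightarrow> w \<in> fcar b \<Longrightarrow> f (v + w) = f v + f w"
    "\<And>r v. v \<in> fcar b \<Longrightarrow> f (pscale r v) = pscale r (f v)"
    "\<And>e. f ` (fcar b \<inter> fdeg e) \<subseteq> fcar c \<inter> fdeg e"
    by (simp_all add: graded_hom_def carrier_free_gmodule grade_free_gmodule)
  have "graded_matrix c \<phi>"
    unfolding graded_matrix_def
  proof
    fix g
    have "f (single g 1) \<in> fcar c \<inter> fdeg (fst g)" if "g \<in> gens b"
      by (rule subsetD[OF f(3) imageI]) (simp add: fcar_single that fdeg_basis)
    then show "\<phi> g \<in> fcar c \<inter> fdeg (fst g)" by (simp add: \<phi>_def)
  qed
  moreover have "f v = lin \<phi> v" if "v \<in> fcar b" for v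
  proof -
    have "f v = lin (\<lambda>g. f (single g 1)) v"
      using that f by (intro additive_eq_lin[where G = "gens b"]) (auto simp: fcar_def)
    also have "\<dots> = lin \<phi> v"
      using that by (intro lin_cong) (auto simp: \<phi>_def fcar_def)
    finally show ?thesis .
  qed
  ultimately show ?thesis by blast
qed

lemma lin_graded_hom:
  "graded_matrix c \<phi> \<Longrightarrow> lin \<phi> \<in> graded_hom (free_gmodule b) (free_gmodule c)"
  by (auto simp: graded_hom_def carrier_free_gmodule grade_free_gmodule lin_fcar lin_add lin_pscale
      intro: lin_fdeg)

section \<open>Uniqueness of minimal resolutions\<close>

text \<open>
  A free complex \<open>\<cdots> \<rightarrow> F\<^sub>2 \<rightarrow> F\<^sub>1 \<rightarrow> F\<^sub>0\<close> that resolves the submodule \<open>N\<close> of \<open>F\<^sub>0\<close>. Minimality is not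
  demanded of \<open>F\<^sub>1 \<rightarrow> F\<^sub>0\<close>, so that for \<open>F\<^sub>0 = R\<close> and \<open>N = I\<close> this covers both the resolutions of \<open>I\<close>
  and those of \<open>R/I\<close>.
\<close>

definition augmented_resolution :: "(nat \<Rightarrow> int \<Rightarrow> nat) \<Rightarrow>
    (nat \<Rightarrow> int \<times> nat \<Rightarrow> ('n::finite, 'k::field) fmod) \<Rightarrow> ('n, 'k) fmod set \<Rightarrow> bool" where
  "augmented_resolution B \<Phi> N \<longleftrightarrow>
    (\<forall>i. graded_matrix (B i) (\<Phi> i)) \<and>
    lin (\<Phi> 0) ` fcar (B 1) = N \<and>
    (\<forall>i. lin (\<Phi> (Suc i)) ` fcar (B (Suc (Suc i))) = {v \<in> fcar (B (Suc i)). lin (\<Phi> i) v = 0}) \<and>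
    (\<forall>i. \<forall>v\<in>fcar (B (Suc (Suc i))). \<forall>g. lookup (lookup (lin (\<Phi> (Suc i)) v) g) 0 = 0)"

text \<open>Graded projectivity of free modules: preimages are chosen on the generators and cut down
  to the degree of the generator. They remain preimages, since \<open>lin \<Psi>\<close> commutes
  with \<open>fpart\<close> and \<open>\<phi> g\<close> is already homogeneous.\<close>

lemma lift_through:
  assumes "graded_matrix c \<Psi>" "graded_matrix c \<phi>" "\<And>g. g \<in> gens b \<Longrightarrow> \<phi> g \<in> lin \<Psi> ` fcar a"
  shows "\<exists>\<eta>. graded_matrix a \<eta> \<and> (\<forall>v\<in>fcar b. lin \<Psi> (lin \<eta> v) = lin \<phi> v)"
proof -
  obtain w where w: "\<And>g. g \<in> gens b \<Longrightarrow> w g \<in> fcar a \<and> lin \<Psi> (w g) = \<phi> g"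
    using bchoice[of "gens b" "\<lambda>g w. w \<in> fcar a \<and> lin \<Psi> w = \<phi> g"] assms(3) by force
  define \<eta> where "\<eta> g = (if g \<in> gens b then fpart (fst g) (w g) else 0)" for g
  have "graded_matrix a \<eta>"
    by (auto simp: graded_matrix_def \<eta>_def w fpart_fcar fpart_fdeg)
  moreover have "lin \<Psi> (\<eta> g) = \<phi> g" if "g \<in> gens b" for g
    using assms(2) that
    by (simp add: \<eta>_def fpart_lin[OF assms(1), symmetric] w graded_matrix_def fpart_id)
  then have "\<forall>v\<in>fcar b. lin \<Psi> (lin \<eta> v) = lin \<phi> v"
    by (auto simp: lin_lin fcar_def intro!: lin_cong)
  ultimately show ?thesis by blast
qed

text \<open>Zero off the generators, since \<open>graded_matrix\<close> demands that every column
  lie in \<open>fcar b\<close>.\<close>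

definition id_matrix :: "(int \<Rightarrow> nat) \<Rightarrow> int \<times> nat \<Rightarrow> ('n::finite, 'k::field) fmod" where
  "id_matrix b g = (if g \<in> gens b then single g 1 else 0)"

lemma id_matrix_graded: "graded_matrix b (id_matrix b)"
  by (simp add: graded_matrix_def id_matrix_def fcar_single fdeg_basis)

lemma lin_id_matrix:
  assumes "v \<in> fcar b"
  shows "lin (id_matrix b) v = v"
proof -
  have "lin (id_matrix b) v = lin (\<lambda>g. single g 1) v"
    using assms by (intro lin_cong) (auto simp: id_matrix_def fcar_def)
  then show ?thesis by (simp add: lin_basis)
qed

lemma graded_matrix_lin:
  "graded_matrix c \<psi> \<Longrightarrow> graded_matrix b \<phi> \<Longrightarrow> graded_matrix c (\<lambda>g. lin \<psi> (\<phi> g))"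
  by (simp add: graded_matrix_def[of b] graded_matrix_def[of c "\<lambda>g. lin \<psi> (\<phi> g)"] lin_fcar lin_fdeg)

lemma homogeneous_part_diff:
  "p \<in> homogeneous_part e \<Longrightarrow> q \<in> homogeneous_part e \<Longrightarrow> p - q \<in> homogeneous_part e"
  using homogeneous_part_add[OF _ homogeneous_part_uminus, of p e q] by simp

lemma fdeg_diff: "v \<in> fdeg e \<Longrightarrow> w \<in> fdeg e \<Longrightarrow> v - w \<in> fdeg e"
  by (simp add: fdeg_def lookup_minus homogeneous_part_diff)

lemma graded_matrix_diff:
  "graded_matrix c \<phi> \<Longrightarrow> graded_matrix c \<psi> \<Longrightarrow> graded_matrix c (\<lambda>g. \<phi> g - \<psi> g)"
  by (simp add: graded_matrix_def fcar_diff fdeg_diff)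

lemma graded_matrix_zero: "graded_matrix c (\<lambda>_. 0)"
  by (simp add: graded_matrix_def)

lemma lin_zero_fun [simp]: "lin (\<lambda>_. 0) v = 0"
  by (simp add: lin_def)

text \<open>The comparison theorem over the identity of \<open>N\<close>. Both complexes begin with
  the same free module, so the lift begins with its identity map.\<close>

lemma chain_map_lift:
  assumes B: "augmented_resolution B \<Phi> N" and B': "augmented_resolution B' \<Phi>' N" and "B 0 = B' 0"
  shows "\<exists>F. (\<forall>i. graded_matrix (B' i) (F i)) \<and> (\<forall>v\<in>fcar (B 0). lin (F 0) v = v) \<and>
    (\<forall>i. \<forall>v\<in>fcar (B (Suc i)). lin (\<Phi>' i) (lin (F (Suc i)) v) = lin (F i) (lin (\<Phi> i) v))"
proof -
  note B = B[unfolded augmented_resolution_def] and B' = B'[unfolded augmented_resolution_def]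
  \<comment> \<open>\<open>P\<close> is the invariant that permits the next lift: boundaries go to
    boundaries. At \<open>i = 0\<close> it holds because both images equal \<open>N\<close>.\<close>
  define P where "P i \<phi> \<longleftrightarrow> graded_matrix (B' i) \<phi> \<and> (i = 0 \<longrightarrow> (\<forall>v\<in>fcar (B 0). lin \<phi> v = v)) \<and>
      (\<forall>v\<in>fcar (B (Suc i)). lin \<phi> (lin (\<Phi> i) v) \<in> lin (\<Phi>' i) ` fcar (B' (Suc i)))" for i \<phi>
  define Q where "Q i \<phi> \<psi> \<longleftrightarrow>
      (\<forall>v\<in>fcar (B (Suc i)). lin (\<Phi>' i) (lin \<psi> v) = lin \<phi> (lin (\<Phi> i) v))" for i \<phi> \<psi>
  have "P 0 (id_matrix (B 0))"
  proof -
    have "lin (id_matrix (B 0)) (lin (\<Phi> 0) v) = lin (\<Phi> 0) v" for v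
      using B by (simp add: lin_id_matrix lin_fcar)
    moreover have "lin (\<Phi> 0) v \<in> lin (\<Phi>' 0) ` fcar (B' (Suc 0))" if "v \<in> fcar (B (Suc 0))" for v
      using B B' that by auto
    ultimately show ?thesis
      using id_matrix_graded[of "B 0"] by (auto simp: P_def lin_id_matrix \<open>B 0 = B' 0\<close>)
  qed
  moreover have "\<exists>\<psi>. P (Suc i) \<psi> \<and> Q i \<phi> \<psi>" if P: "P i \<phi>" for i \<phi>
  proof -
    have "lin \<phi> (\<Phi> i g) \<in> lin (\<Phi>' i) ` fcar (B' (Suc i))" if "g \<in> gens (B (Suc i))" for g
      using P fcar_single[OF that, of 1] unfolding P_def by force
    with P B B' have "\<exists>\<psi>. graded_matrix (B' (Suc i)) \<psi> \<and>
        (\<forall>v\<in>fcar (B (Suc i)). lin (\<Phi>' i) (lin \<psi> v) = lin (\<lambda>g. lin \<phi> (\<Phi> i g)) v)"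
      by (intro lift_through[where c = "B' i"] graded_matrix_lin[where b = "B i"]) (auto simp: P_def)
    then obtain \<psi> where \<psi>: "graded_matrix (B' (Suc i)) \<psi>"
        "\<And>v. v \<in> fcar (B (Suc i)) \<Longrightarrow> lin (\<Phi>' i) (lin \<psi> v) = lin \<phi> (lin (\<Phi> i) v)"
      by (auto simp: lin_lin)
    have "lin \<psi> (lin (\<Phi> (Suc i)) v) \<in> lin (\<Phi>' (Suc i)) ` fcar (B' (Suc (Suc i)))"
      if "v \<in> fcar (B (Suc (Suc i)))" for v
    proof -
      \<comment> \<open>Consecutive differentials compose to 0, so the commuting square sends this
        vector into the kernel of \<open>\<Phi>' i\<close>, which exactness of the second complex
        turns into an image.\<close>
      have "lin (\<Phi> (Suc i)) v \<in> {v \<in> fcar (B (Suc i)). lin (\<Phi> i) v = 0}"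
        using B that by blast
      then have "lin \<psi> (lin (\<Phi> (Suc i)) v) \<in> {v \<in> fcar (B' (Suc i)). lin (\<Phi>' i) v = 0}"
        using \<psi> by (auto simp: lin_fcar)
      with B' show ?thesis by simp
    qed
    with \<psi> show ?thesis by (auto simp: P_def Q_def)
  qed
  ultimately obtain F where "\<forall>i. P i (F i) \<and> Q i (F i) (F (Suc i))"
    using dependent_nat_choice[of P Q] by blast
  then show ?thesis unfolding P_def Q_def by blast
qed

text \<open>Two lifts of the identity of \<open>N\<close> are homotopic; here one of them is the
  identity itself. The homotopy starts with 0 because \<open>E 0\<close> already acts as the
  identity on the lowest free module.\<close>

lemma chain_endomorphism_homotopy:
  assumes B: "augmented_resolution B \<Phi> N"
    and E: "\<And>i. graded_matrix (B i) (E i)" "\<And>v. v \<in> fcar (B 0) \<Longrightarrow> lin (E 0) v = v"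
      "\<And>i v. v \<in> fcar (B (Suc i)) \<Longrightarrow> lin (\<Phi> i) (lin (E (Suc i)) v) = lin (E i) (lin (\<Phi> i) v)"
  shows "\<exists>S. S 0 = (\<lambda>_. 0) \<and> (\<forall>i. graded_matrix (B (Suc i)) (S i)) \<and>
    (\<forall>i. \<forall>v\<in>fcar (B (Suc i)).
      lin (\<Phi> (Suc i)) (lin (S (Suc i)) v) = lin (E (Suc i)) v - v - lin (S i) (lin (\<Phi> i) v))"
proof -
  note B = B[unfolded augmented_resolution_def]
  \<comment> \<open>\<open>P\<close> says that the defect \<open>E - id - S d\<close> is a cycle,
    hence a boundary by exactness; \<open>Q\<close> says that the next \<open>\<tau>\<close>
    exhibits it as one.\<close>
  define P where "P i \<sigma> \<longleftrightarrow> graded_matrix (B (Suc i)) \<sigma> \<and> (i = 0 \<longrightarrow> \<sigma> = (\<lambda>_. 0)) \<and>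
      (\<forall>v\<in>fcar (B (Suc i)). lin (\<Phi> i) (lin (E (Suc i)) v - v - lin \<sigma> (lin (\<Phi> i) v)) = 0)" for i \<sigma>
  define Q where "Q i \<sigma> \<tau> \<longleftrightarrow> (\<forall>v\<in>fcar (B (Suc i)).
      lin (\<Phi> (Suc i)) (lin \<tau> v) = lin (E (Suc i)) v - v - lin \<sigma> (lin (\<Phi> i) v))" for i \<sigma> \<tau>
  have "P 0 (\<lambda>_. 0)"
    using B by (simp add: P_def graded_matrix_zero lin_diff E lin_fcar)
  moreover have "\<exists>\<tau>. P (Suc i) \<tau> \<and> Q i \<sigma> \<tau>" if P: "P i \<sigma>" for i \<sigma>
  proof -
    \<comment> \<open>The defect as a matrix: \<open>id_matrix\<close> stands for the subtracted
      \<open>v\<close>, so that \<open>lift_through\<close> applies.\<close>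
    define \<phi> where "\<phi> g = E (Suc i) g - id_matrix (B (Suc i)) g - lin \<sigma> (\<Phi> i g)" for g
    have gr: "graded_matrix (B (Suc i)) \<phi>"
      unfolding \<phi>_def using P B
      by (intro graded_matrix_diff E id_matrix_graded graded_matrix_lin[where b = "B i"])
         (auto simp: P_def)
    have \<phi>: "lin \<phi> v = lin (E (Suc i)) v - v - lin \<sigma> (lin (\<Phi> i) v)" if "v \<in> fcar (B (Suc i))" for v
      using that by (simp add: \<phi>_def[abs_def] lin_minus_fun lin_id_matrix lin_lin)
    have "\<phi> g \<in> lin (\<Phi> (Suc i)) ` fcar (B (Suc (Suc i)))" if "g \<in> gens (B (Suc i))" for g
    proof -
      have "lin (\<Phi> i) (\<phi> g) = 0"
        using P \<phi>[OF fcar_single[OF that, of 1]] fcar_single[OF that, of 1]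
        unfolding P_def by force
      with gr B show ?thesis by (auto simp: graded_matrix_def)
    qed
    moreover have "graded_matrix (B (Suc i)) (\<Phi> (Suc i))" using B by blast
    ultimately obtain \<tau> where \<tau>: "graded_matrix (B (Suc (Suc i))) \<tau>"
        "\<And>v. v \<in> fcar (B (Suc i)) \<Longrightarrow> lin (\<Phi> (Suc i)) (lin \<tau> v) = lin \<phi> v"
      using lift_through[OF _ gr] by metis
    have "lin (\<Phi> (Suc i)) (lin (E (Suc (Suc i))) v - v - lin \<tau> (lin (\<Phi> (Suc i)) v)) = 0"
      if v: "v \<in> fcar (B (Suc (Suc i)))" for v
    proof -
      have "lin (\<Phi> (Suc i)) v \<in> {v \<in> fcar (B (Suc i)). lin (\<Phi> i) v = 0}"
        using B v by blast
      then show ?thesis using v by (simp add: lin_diff E(3) \<tau>(2) \<phi>)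
    qed
    with \<tau> \<phi> show ?thesis by (auto simp: P_def Q_def)
  qed
  ultimately obtain F where "\<forall>i. P i (F i) \<and> Q i (F i) (F (Suc i))"
    using dependent_nat_choice[of P Q] by blast
  then show ?thesis unfolding P_def Q_def by blast
qed

section \<open>Reduction of free modules modulo the maximal ideal\<close>

definition const_part :: "('n::finite, 'k::field) fmod \<Rightarrow> (int \<times> nat) \<Rightarrow>\<^sub>0 'k" where
  "const_part = Poly_Mapping.map (\<lambda>p. lookup p 0)"

lemma lookup_const_part [simp]: "lookup (const_part v) g = lookup (lookup v g) 0"
  by (simp add: const_part_def map.rep_eq when_def)

lemma const_part_add: "const_part (v + w) = const_part v + const_part w"
  by (rule poly_mapping_eqI) (simp add: lookup_add)

lemma const_part_lin: "const_part (lin \<phi> v) = lin (\<lambda>g. const_part (\<phi> g)) (const_part v)"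
proof (rule poly_mapping_eqI)
  fix h
  have "keys (const_part v) \<subseteq> keys v" by (auto simp: in_keys_iff)
  then show "lookup (const_part (lin \<phi> v)) h = lookup (lin (\<lambda>g. const_part (\<phi> g)) (const_part v)) h"
    by (simp add: lookup_lin lookup_sum lookup_mult_0 lin_superset[OF finite_keys])
qed

interpretation pv: vector_space "pscale :: 'k::field \<Rightarrow> ('a \<Rightarrow>\<^sub>0 'k) \<Rightarrow> _"
  by (simp add: module_iff_vector_space[symmetric] pm.module_axioms)

text \<open>\<open>lin \<beta>\<close> sends the vectors \<open>\<alpha> a\<close> to distinct unit
  vectors, so they are linearly independent, and they lie in the span of the unit vectors of
  \<open>C\<close>.\<close>

lemma left_inverse_card_le:
  fixes \<alpha> :: "'a \<Rightarrow> ('b \<Rightarrow>\<^sub>0 'k::field)" and \<beta> :: "'b \<Rightarrow> ('a \<Rightarrow>\<^sub>0 'k)"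
  assumes "finite A" "finite C" "\<And>a. a \<in> A \<Longrightarrow> keys (\<alpha> a) \<subseteq> C"
    and inv: "\<And>a. a \<in> A \<Longrightarrow> lin \<beta> (\<alpha> a) = single a 1"
  shows "card A \<le> card C"
proof -
  have inj: "inj_on \<alpha> A"
    by (rule inj_onI) (metis inv inj_single keys_single singleton_inject zero_neq_one)
  have ind: "pm.independent (\<alpha> ` A)"
  proof (rule pv.independent_if_scalars_zero)
    fix f x assume f: "(\<Sum>x\<in>\<alpha> ` A. pscale (f x) x) = 0" and "x \<in> \<alpha> ` A"
    then obtain a where a: "a \<in> A" "x = \<alpha> a" by auto
    have "0 = lin \<beta> (\<Sum>x\<in>\<alpha> ` A. pscale (f x) x)" by (simp add: f)
    also have "\<dots> = (\<Sum>b\<in>A. single b (f (\<alpha> b)))"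
      by (simp add: lin_sum lin_pscale sum.reindex[OF inj] inv)
    finally have "lookup (\<Sum>b\<in>A. single b (f (\<alpha> b))) a = 0" by simp
    then show "f x = 0"
      using a \<open>finite A\<close> by (simp add: lookup_sum lookup_single when_def)
  qed (use assms in simp)
  have "\<alpha> ` A \<subseteq> pm.span ((\<lambda>c. single c 1) ` C)"
  proof
    fix x assume "x \<in> \<alpha> ` A"
    then have "keys x \<subseteq> C" using assms by auto
    then show "x \<in> pm.span ((\<lambda>c. single c 1) ` C)"
      by (subst lin_basis[of x, symmetric], unfold lin_def)
         (intro pm.span_sum pm.span_scale pm.span_base, auto)
  qed
  with ind have "card (\<alpha> ` A) \<le> card ((\<lambda>c. single c (1::'k)) ` C)"
    using pv.independent_span_bound[of "(\<lambda>c. single c 1) ` C" "\<alpha> ` A"] assms(2) by simp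
  also have "\<dots> \<le> card C" by (rule card_image_le[OF assms(2)])
  finally show ?thesis by (simp add: card_image[OF inj])
qed

text \<open>
  A composite of chain maps lifting the identity is homotopic to the identity. By minimality the
  homotopy vanishes modulo the maximal ideal, so the constant parts of the two chain maps are
  matrices over the field with one-sided inverse.
\<close>

lemma augmented_resolution_rank_le:
  fixes \<Phi> \<Phi>' :: "nat \<Rightarrow> int \<times> nat \<Rightarrow> ('n::finite, 'k::field) fmod"
  assumes B: "augmented_resolution B \<Phi> N" and B': "augmented_resolution B' \<Phi>' N" and "B 0 = B' 0"
  shows "B i j \<le> B' i j"
proof (cases i)
  case 0
  then show ?thesis using assms by simp
next
  case (Suc i')
  obtain F where F: "\<And>i. graded_matrix (B' i) (F i)" "\<And>v. v \<in> fcar (B 0) \<Longrightarrow> lin (F 0) v = v"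
    "\<And>i v. v \<in> fcar (B (Suc i)) \<Longrightarrow> lin (\<Phi>' i) (lin (F (Suc i)) v) = lin (F i) (lin (\<Phi> i) v)"
    using chain_map_lift[OF B B' \<open>B 0 = B' 0\<close>] by blast
  obtain G where G: "\<And>i. graded_matrix (B i) (G i)" "\<And>v. v \<in> fcar (B' 0) \<Longrightarrow> lin (G 0) v = v"
    "\<And>i v. v \<in> fcar (B' (Suc i)) \<Longrightarrow> lin (\<Phi> i) (lin (G (Suc i)) v) = lin (G i) (lin (\<Phi>' i) v)"
    using chain_map_lift[OF B' B \<open>B 0 = B' 0\<close>[symmetric]] by blast
  define E where "E i g = lin (G i) (F i g)" for i g
  have E: "graded_matrix (B i) (E i)" for i
    unfolding E_def by (rule graded_matrix_lin[OF G(1) F(1)])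
  have linE: "lin (E i) v = lin (G i) (lin (F i) v)" for i v
    by (simp add: E_def[abs_def] lin_lin)
  obtain S where S0: "S 0 = (\<lambda>_. 0)" and S: "\<And>i. graded_matrix (B (Suc i)) (S i)"
    and hom: "\<And>i v. v \<in> fcar (B (Suc i)) \<Longrightarrow>
      lin (\<Phi> (Suc i)) (lin (S (Suc i)) v) = lin (E (Suc i)) v - v - lin (S i) (lin (\<Phi> i) v)"
    using chain_endomorphism_homotopy[OF B, of E] E
    by (auto simp: linE F G lin_fcar[OF F(1)] \<open>B 0 = B' 0\<close>)
  have min: "const_part (lin (\<Phi> (Suc i)) v) = 0" if "v \<in> fcar (B (Suc (Suc i)))" for i v
    using B that by (auto simp: augmented_resolution_def intro!: poly_mapping_eqI)
  have inv: "const_part (lin (E (Suc i)) v) = const_part v" if v: "v \<in> fcar (B (Suc i))" for i v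
  proof -
    have eq: "lin (E (Suc i)) v = lin (\<Phi> (Suc i)) (lin (S (Suc i)) v) + v + lin (S i) (lin (\<Phi> i) v)"
      using hom[OF v] by simp
    have "const_part (lin (S i) (lin (\<Phi> i) v)) = 0"
    proof (cases i)
      \<comment> \<open>\<open>\<Phi> 0\<close> may fail to be minimal; here the term vanishes
        because \<open>S 0 = 0\<close>.\<close>
      case 0
      then show ?thesis by (auto simp: S0 intro!: poly_mapping_eqI)
    next
      case (Suc l)
      then show ?thesis using min[of v l] v by (simp add: const_part_lin)
    qed
    then show ?thesis
      unfolding eq const_part_add using min[OF lin_fcar[OF S]] by simp
  qed
  \<comment> \<open>A module may have infinitely many generators, but only finitely many of degree
    \<open>j\<close>, and by \<open>fdeg_lookup_0\<close> the constant part of \<open>F i\<close>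
    maps the block of degree \<open>j\<close> into the block of degree \<open>j\<close>.\<close>
  have "card ({j} \<times> {..<B i j}) \<le> card ({j} \<times> {..<B' i j})"
  proof (rule left_inverse_card_le)
    fix a assume "a \<in> {j} \<times> {..<B i j}"
    then have a: "a \<in> gens (B i)" "fst a = j" by (auto simp: gens_def)
    have "h \<in> {j} \<times> {..<B' i j}" if "h \<in> keys (const_part (F i a))" for h
    proof -
      have "lookup (lookup (F i a) h) 0 \<noteq> 0" using that by (simp add: in_keys_iff)
      moreover have "F i a \<in> fcar (B' i)" "F i a \<in> fdeg j"
        using F(1) a by (auto simp: graded_matrix_def)
      moreover from calculation have "lookup (F i a) h \<noteq> 0" by auto
      ultimately have "fst h = j" "h \<in> gens (B' i)"
        using fdeg_lookup_0[of "F i a" j h] by (auto simp: fcar_def in_keys_iff subset_iff)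
      then show ?thesis by (auto simp: gens_def)
    qed
    then show "keys (const_part (F i a)) \<subseteq> {j} \<times> {..<B' i j}" by blast
    have "lin (\<lambda>g. const_part (G i g)) (const_part (F i a)) = const_part (lin (E i) (single a 1))"
      by (simp add: const_part_lin E_def)
    also have "\<dots> = const_part (single a 1 :: ('n, 'k) fmod)"
      unfolding Suc by (rule inv, rule fcar_single) (use a Suc in simp)
    also have "\<dots> = single a 1"
      by (rule poly_mapping_eqI) (simp add: lookup_single when_def)
    finally show "lin (\<lambda>g. const_part (G i g)) (const_part (F i a)) = single a 1" .
  qed auto
  then show ?thesis by simp
qed

lemma augmented_resolution_unique:
  assumes "augmented_resolution B \<Phi> N" "augmented_resolution B' \<Phi>' N" "B 0 = B' 0"
  shows "B = B'"
  using augmented_resolution_rank_le[OF assms]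
    augmented_resolution_rank_le[OF assms(2,1) assms(3)[symmetric]]
  by (intro ext antisym)

section \<open>Resolutions of an ideal and of its quotient ring\<close>

definition unit_rank :: "int \<Rightarrow> nat" where
  "unit_rank j = (if j = 0 then 1 else 0)"

lemma gens_unit_rank: "gens unit_rank = {(0, 0)}"
  by (auto simp: gens_def unit_rank_def split: if_splits)

text \<open>The indices in one degree form an initial segment, so a lone generator has index
  0.\<close>

lemma rank_eq_unit_rank:
  assumes "gens b = {(0, k)}"
  shows "b = unit_rank" "k = 0"
proof -
  have b: "i < b j \<longleftrightarrow> j = 0 \<and> i = k" for i j
    using assms unfolding gens_def set_eq_iff by auto
  have "k < b 0" using b by blast
  then show "k = 0" using b[of 0 0] by simp
  then have "b j = (if j = 0 then 1 else 0)" for j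
    using b[of 0 j] b[of 1 j] by (cases "b j") auto
  then show "b = unit_rank" by (auto simp: unit_rank_def)
qed

abbreviation emb :: "('n::finite, 'k::field) mpoly \<Rightarrow> ('n, 'k) fmod" where
  "emb \<equiv> single (0, 0)"

lemma fcar_unit_rank: "v \<in> fcar unit_rank \<longleftrightarrow> v = emb (lookup v (0, 0))"
proof
  assume "v \<in> fcar unit_rank"
  then show "v = emb (lookup v (0, 0))"
    by (intro poly_mapping_eqI[of v])
      (use \<open>v \<in> fcar unit_rank\<close> in \<open>force simp: fcar_def gens_unit_rank lookup_single when_def not_in_keys_iff_lookup_eq_zero\<close>)
qed (metis fcar_single gens_unit_rank insertI1)

lemma emb_fcar [simp]: "emb p \<in> fcar unit_rank"
  by (simp add: fcar_unit_rank)

lemma emb_fdeg_iff: "emb p \<in> fdeg e \<longleftrightarrow> p \<in> homogeneous_part e"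
  by (auto simp: fdeg_def lookup_single when_def split: if_splits)

lemma emb_image_iff: "v \<in> emb ` I \<longleftrightarrow> v \<in> fcar unit_rank \<and> lookup v (0, 0) \<in> I"
  by (metis fcar_unit_rank image_iff lookup_single_eq)

lemma resolution_differentials:
  assumes "minimal_graded_free_resolution M b \<epsilon> \<delta>"
  shows "\<exists>\<Psi>. \<forall>i. graded_matrix (b i) (\<Psi> i) \<and> (\<forall>v\<in>fcar (b (Suc i)). \<delta> i v = lin (\<Psi> i) v)"
proof -
  have "\<delta> i \<in> graded_hom (free_gmodule (b (Suc i))) (free_gmodule (b i))" for i
    using assms by (simp add: minimal_graded_free_resolution_def)
  then show ?thesis by (intro choice allI graded_hom_eq_lin)
qed

lemma ideal_gmodule_simps [simp]:
  "carrier (ideal_gmodule I) = I" "add (ideal_gmodule I) = (+)" "zero (ideal_gmodule I) = 0"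
  "module.smult (ideal_gmodule I) = (*)" "grade (ideal_gmodule I) e = I \<inter> homogeneous_part e"
  by (simp_all add: ideal_gmodule_def)

text \<open>Following \<open>\<epsilon>\<close> by the inclusion of \<open>I\<close> in
  \<open>R\<close> turns the augmentation into a lowest differential with image \<open>I\<close>.
  The ranks move up by one place, which is what \<open>case_nat unit_rank b\<close>
  expresses.\<close>

lemma ideal_resolution_iff:
  fixes I :: "('n::finite, 'k::field) mpoly set"
  shows "(\<exists>\<epsilon> \<delta>. minimal_graded_free_resolution (ideal_gmodule I) b \<epsilon> \<delta>) \<longleftrightarrow>
    (\<exists>\<Phi>. augmented_resolution (case_nat unit_rank b) \<Phi> (emb ` I))"
proof
  assume "\<exists>\<epsilon> \<delta>. minimal_graded_free_resolution (ideal_gmodule I) b \<epsilon> \<delta>"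
  then obtain \<epsilon> \<delta> where res: "minimal_graded_free_resolution (ideal_gmodule I) b \<epsilon> \<delta>" by blast
  note r = res[unfolded minimal_graded_free_resolution_def carrier_free_gmodule ideal_gmodule_simps]
  obtain \<Psi> where \<Psi>: "\<And>i. graded_matrix (b i) (\<Psi> i)"
      "\<And>i v. v \<in> fcar (b (Suc i)) \<Longrightarrow> \<delta> i v = lin (\<Psi> i) v"
    using resolution_differentials[OF res] by blast
  have "(\<lambda>v. emb (\<epsilon> v)) \<in> graded_hom (free_gmodule (b 0)) (free_gmodule unit_rank)"
    using r by (auto simp: graded_hom_def carrier_free_gmodule grade_free_gmodule single_add
        image_subset_iff emb_fdeg_iff)
  then obtain \<phi> where \<phi>: "graded_matrix unit_rank \<phi>" "\<And>v. v \<in> fcar (b 0) \<Longrightarrow> emb (\<epsilon> v) = lin \<phi> v"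
    using graded_hom_eq_lin by blast
  have ker: "lin \<phi> v = 0 \<longleftrightarrow> \<epsilon> v = 0" if "v \<in> fcar (b 0)" for v
    using \<phi>(2)[OF that] by (metis lookup_single_eq lookup_zero single_zero)
  have "augmented_resolution (case_nat unit_rank b) (case_nat \<phi> \<Psi>) (emb ` I)"
    unfolding augmented_resolution_def
  proof (intro conjI allI ballI)
    fix i
    show "graded_matrix (case i of 0 \<Rightarrow> unit_rank | Suc x \<Rightarrow> b x) (case i of 0 \<Rightarrow> \<phi> | Suc x \<Rightarrow> \<Psi> x)"
      using \<phi> \<Psi> by (simp split: nat.split)
    have "lin \<phi> ` fcar (b 0) = emb ` \<epsilon> ` fcar (b 0)"
      by (simp add: image_image \<phi>(2))
    also have "\<dots> = emb ` I" using r by simp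
    finally show "lin (case 0 of 0 \<Rightarrow> \<phi> | Suc x \<Rightarrow> \<Psi> x) ` fcar (case 1 of 0 \<Rightarrow> unit_rank | Suc x \<Rightarrow> b x) = emb ` I"
      by simp
    have im: "lin (\<Psi> i) ` fcar (b (Suc i)) = \<delta> i ` fcar (b (Suc i))" for i
      by (simp add: \<Psi>(2))
    show "lin (case Suc i of 0 \<Rightarrow> \<phi> | Suc x \<Rightarrow> \<Psi> x) ` fcar (case Suc (Suc i) of 0 \<Rightarrow> unit_rank | Suc x \<Rightarrow> b x)
       = {v \<in> fcar (case Suc i of 0 \<Rightarrow> unit_rank | Suc x \<Rightarrow> b x). lin (case i of 0 \<Rightarrow> \<phi> | Suc x \<Rightarrow> \<Psi> x) v = 0}"
    proof (cases i)
      case 0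
      have "\<delta> 0 ` fcar (b (Suc 0)) = {v \<in> fcar (b 0). \<epsilon> v = 0}" using r by simp
      also have "\<dots> = {v \<in> fcar (b 0). lin \<phi> v = 0}" using ker by blast
      finally show ?thesis by (simp add: 0 im)
    next
      case (Suc l)
      have "\<delta> (Suc l) ` fcar (b (Suc (Suc l))) = {v \<in> fcar (b (Suc l)). \<delta> l v = 0}" using r by simp
      also have "\<dots> = {v \<in> fcar (b (Suc l)). lin (\<Psi> l) v = 0}" using \<Psi>(2) by auto
      finally show ?thesis by (simp add: Suc im)
    qed
    fix v :: "('n, 'k) fmod" and g assume "v \<in> fcar (case Suc (Suc i) of 0 \<Rightarrow> unit_rank | Suc x \<Rightarrow> b x)"
    then have v: "v \<in> fcar (b (Suc i))" by simp
    then show "lookup (lookup (lin (case Suc i of 0 \<Rightarrow> \<phi> | Suc x \<Rightarrow> \<Psi> x) v) g) 0 = 0"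
      using r by (simp add: \<Psi>(2)[OF v, symmetric])
  qed
  then show "\<exists>\<Phi>. augmented_resolution (case_nat unit_rank b) \<Phi> (emb ` I)" by blast
next
  assume "\<exists>\<Phi>. augmented_resolution (case_nat unit_rank b) \<Phi> (emb ` I)"
  then obtain \<Phi> where res: "augmented_resolution (case_nat unit_rank b) \<Phi> (emb ` I)" ..
  have gr0: "graded_matrix unit_rank (\<Phi> 0)" and gr: "\<And>i. graded_matrix (b i) (\<Phi> (Suc i))"
    and im: "lin (\<Phi> 0) ` fcar (b 0) = emb ` I"
    and ex0: "lin (\<Phi> (Suc 0)) ` fcar (b (Suc 0)) = {v \<in> fcar (b 0). lin (\<Phi> 0) v = 0}"
    and ex: "\<And>i. lin (\<Phi> (Suc (Suc i))) ` fcar (b (Suc (Suc i))) = {v \<in> fcar (b (Suc i)). lin (\<Phi> (Suc i)) v = 0}"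
    and min: "\<And>i v g. v \<in> fcar (b (Suc i)) \<Longrightarrow> lookup (lookup (lin (\<Phi> (Suc i)) v) g) 0 = 0"
    using res unfolding augmented_resolution_def by (force split: nat.splits)+
  define \<epsilon> where "\<epsilon> v = lookup (lin (\<Phi> 0) v) (0, 0)" for v
  have \<epsilon>: "lin (\<Phi> 0) v = emb (\<epsilon> v)" for v
    using lin_fcar[OF gr0] by (simp add: \<epsilon>_def fcar_unit_rank[symmetric])
  have \<epsilon>I: "\<epsilon> ` fcar (b 0) = I"
  proof -
    have "\<epsilon> ` fcar (b 0) = (\<lambda>v. lookup v (0, 0)) ` lin (\<Phi> 0) ` fcar (b 0)"
      by (simp add: image_image \<epsilon>_def)
    also have "\<dots> = I" by (simp add: im image_image)
    finally show ?thesis .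
  qed
  have "\<epsilon> v \<in> homogeneous_part e" if "v \<in> fdeg e" for v e
    using lin_fdeg[OF gr0 that] by (simp add: \<epsilon> emb_fdeg_iff)
  then have \<epsilon>h: "\<epsilon> \<in> graded_hom (free_gmodule (b 0)) (ideal_gmodule I)"
    using \<epsilon>I by (auto simp: graded_hom_def carrier_free_gmodule grade_free_gmodule)
      (simp_all add: \<epsilon>_def lin_add lookup_add lin_pscale)
  have "{v \<in> fcar (b 0). lin (\<Phi> 0) v = 0} = {v \<in> fcar (b 0). \<epsilon> v = 0}"
    by (metis \<epsilon> lookup_single_eq lookup_zero single_zero)
  then have "minimal_graded_free_resolution (ideal_gmodule I) b \<epsilon> (\<lambda>i. lin (\<Phi> (Suc i)))"
    unfolding minimal_graded_free_resolution_def carrier_free_gmodule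
    using \<epsilon>h \<epsilon>I ex0 ex min lin_graded_hom[OF gr] by simp
  then show "\<exists>\<epsilon> \<delta>. minimal_graded_free_resolution (ideal_gmodule I) b \<epsilon> \<delta>" by blast
qed

section \<open>The quotient ring and its augmentations\<close>

lemma mpoly_ring_simps [simp]:
  "carrier mpoly_ring = UNIV" "add mpoly_ring = (+)" "monoid.mult mpoly_ring = (*)"
  "zero mpoly_ring = 0" "one mpoly_ring = 1"
  by (simp_all add: ring_of_type_algebra_def)

abbreviation residue_class :: "('n::finite, 'k::field) mpoly set \<Rightarrow> ('n, 'k) mpoly \<Rightarrow> ('n, 'k) mpoly set" where
  "residue_class I p \<equiv> I +>\<^bsub>mpoly_ring\<^esub> p"

context
  fixes I :: "('n::finite, 'k::field) mpoly set"
  assumes ideal: "ideal I mpoly_ring"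
begin

interpretation I: ideal I mpoly_ring by (rule ideal)

lemma ideal_module_subspace: "0 \<in> I" "p \<in> I \<Longrightarrow> q \<in> I \<Longrightarrow> p + q \<in> I" "p \<in> I \<Longrightarrow> r * p \<in> I"
  using I.a_closed I.I_l_closed I.zero_closed additive_subgroup.zero_closed[OF I.additive_subgroup_axioms]
    additive_subgroup.a_closed[OF I.additive_subgroup_axioms, of p q]
  by auto

lemma ideal_diff_closed: "p \<in> I \<Longrightarrow> q \<in> I \<Longrightarrow> p - q \<in> I"
  using ideal_module_subspace(2)[of p "- q"] ideal_module_subspace(3)[of q "- 1"] by simp

lemma residue_class_eq_iff: "residue_class I p = residue_class I q \<longleftrightarrow> p - q \<in> I"
proof -
  have rc: "residue_class I p = {h + p | h. h \<in> I}" for p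
    by (auto simp: a_r_coset_def r_coset_def)
  show ?thesis
  proof
    assume "residue_class I p = residue_class I q"
    moreover have "p \<in> residue_class I p" using ideal_module_subspace(1) by (force simp: rc)
    ultimately show "p - q \<in> I" by (auto simp: rc)
  next
    assume *: "p - q \<in> I"
    have "h + p = (h + (p - q)) + q" "h + q = (h - (p - q)) + p" for h by simp_all
    then show "residue_class I p = residue_class I q"
      unfolding rc using * ideal_module_subspace(2) ideal_diff_closed by blast
  qed
qed

lemma residue_class_zero: "residue_class I 0 = I"
  by (auto simp: a_r_coset_def r_coset_def)

lemma quotient_gmodule_simps:
  "carrier (quotient_gmodule I) = range (residue_class I)"
  "zero (quotient_gmodule I) = I"
  "residue_class I p \<oplus>\<^bsub>quotient_gmodule I\<^esub> residue_class I q = residue_class I (p + q)"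
  "r \<odot>\<^bsub>quotient_gmodule I\<^esub> residue_class I p = residue_class I (r * p)"
  "grade (quotient_gmodule I) e = residue_class I ` homogeneous_part e"
  using I.a_rcos_sum[of p q] I.rcoset_mult_add[of r p]
  by (auto simp: quotient_gmodule_def Let_def FactRing_def A_RCOSETS_def RCOSETS_def a_r_coset_def)

text \<open>The augmentation in a minimal resolution of \<open>R/I\<close> may differ from the
  canonical projection, but only by a nonzero scalar. Some generator must go to a class with nonzero
  constant term, as the class of 1 is reached and \<open>I\<close> has no constant terms; a second
  generator would satisfy a relation with a coefficient outside the maximal ideal, against
  minimality.\<close>

lemma cyclic_resolution:
  assumes max: "\<forall>p\<in>I. lookup p 0 = 0"
    and res: "minimal_graded_free_resolution (quotient_gmodule I) b \<epsilon> \<delta>"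
  shows "b 0 = unit_rank" "{v \<in> fcar (b 0). \<epsilon> v = I} = emb ` I"
proof -
  note r = res[unfolded minimal_graded_free_resolution_def carrier_free_gmodule quotient_gmodule_simps]
  have \<epsilon>h: "\<epsilon> \<in> graded_hom (free_gmodule (b 0)) (quotient_gmodule I)" using r by simp
  have ker: "{v \<in> fcar (b 0). \<epsilon> v = I} = \<delta> 0 ` fcar (b 1)" using r by simp
  have min: "lookup (lookup w g) 0 = 0" if "w \<in> fcar (b 0)" "\<epsilon> w = I" for w g
  proof -
    have "w \<in> \<delta> 0 ` fcar (b 1)" unfolding ker[symmetric] using that by simp
    then obtain u where "u \<in> fcar (b (Suc 0))" "w = \<delta> 0 u" by auto
    moreover have "\<forall>v\<in>fcar (b (Suc 0)). \<forall>g. lookup (lookup (\<delta> 0 v) g) 0 = 0" using r by blast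
    ultimately show ?thesis by blast
  qed
  have \<epsilon>add: "\<epsilon> (v + w) = \<epsilon> v \<oplus>\<^bsub>quotient_gmodule I\<^esub> \<epsilon> w" if "v \<in> fcar (b 0)" "w \<in> fcar (b 0)" for v w
    using \<epsilon>h that by (simp add: graded_hom_def carrier_free_gmodule)
  have \<epsilon>scale: "\<epsilon> (pscale s v) = s \<odot>\<^bsub>quotient_gmodule I\<^esub> \<epsilon> v" if "v \<in> fcar (b 0)" for v s
    using \<epsilon>h that by (simp add: graded_hom_def carrier_free_gmodule)
  have "\<exists>p\<in>homogeneous_part (fst g). \<epsilon> (single g 1) = residue_class I p" if "g \<in> gens (b 0)" for g
  proof -
    have "\<epsilon> ` (fcar (b 0) \<inter> fdeg (fst g)) \<subseteq> residue_class I ` homogeneous_part (fst g)"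
      using \<epsilon>h by (simp add: graded_hom_def grade_free_gmodule quotient_gmodule_simps)
    moreover have "single g 1 \<in> fcar (b 0) \<inter> fdeg (fst g)"
      by (simp add: fcar_single that fdeg_basis)
    ultimately show ?thesis by blast
  qed
  then obtain \<rho> where \<rho>: "\<And>g. g \<in> gens (b 0) \<Longrightarrow> \<rho> g \<in> homogeneous_part (fst g)"
      "\<And>g. g \<in> gens (b 0) \<Longrightarrow> \<epsilon> (single g 1) = residue_class I (\<rho> g)"
    by metis
  \<comment> \<open>\<open>L\<close> lifts \<open>\<epsilon>\<close> to a map into \<open>R\<close>
    by means of the homogeneous representatives \<open>\<rho> g\<close>.\<close>
  define L where "L v = (\<Sum>g\<in>keys v. lookup v g * \<rho> g)" for v
  have L: "L v = lookup (lin (\<lambda>g. emb (\<rho> g)) v) (0, 0)" for v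
    by (simp add: L_def lookup_lin)
  have \<epsilon>: "\<epsilon> v = residue_class I (L v)" if "v \<in> fcar (b 0)" for v
  proof -
    have "keys v \<subseteq> gens (b 0)" using that by (simp add: fcar_def)
    then show ?thesis
    proof (induction rule: poly_mapping_keys_induct)
      case zero
      have "\<epsilon> 0 \<in> \<epsilon> ` fcar (b 0)" by simp
      also have "\<dots> = range (residue_class I)" using r by simp
      finally obtain p where p: "\<epsilon> 0 = residue_class I p" by blast
      have "\<epsilon> (pscale 0 0) = residue_class I (0 * p)"
        by (subst \<epsilon>scale) (simp_all only: fcar_zero p quotient_gmodule_simps)
      then show ?case by (simp add: L_def)
    next
      case (add v w)
      then show ?case
        by (simp add: \<epsilon>add fcar_def quotient_gmodule_simps L lin_add lookup_add)
    next
      case (single g c)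
      have "\<epsilon> (pscale c (single g 1)) = c \<odot>\<^bsub>quotient_gmodule I\<^esub> \<epsilon> (single g 1)"
        using single by (intro \<epsilon>scale fcar_single)
      also have "\<dots> = residue_class I (c * \<rho> g)"
        using single by (simp add: \<rho> quotient_gmodule_simps)
      finally show ?case by (simp add: L)
    qed
  qed
  have kerL: "\<epsilon> v = I \<longleftrightarrow> L v \<in> I" if "v \<in> fcar (b 0)" for v
    using residue_class_eq_iff[of "L v" 0] by (simp add: residue_class_zero \<epsilon>[OF that])
  have "residue_class I 1 \<in> \<epsilon> ` fcar (b 0)"
    using r by auto
  then obtain v where v: "v \<in> fcar (b 0)" "residue_class I 1 = residue_class I (L v)"
    using \<epsilon> by auto
  then have "lookup (1 - L v) 0 = 0"
    using max residue_class_eq_iff by blast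
  then have "(\<Sum>g\<in>keys v. lookup (lookup v g) 0 * lookup (\<rho> g) 0) = 1"
    by (simp add: lookup_minus L_def lookup_sum lookup_mult_0)
  then have "(\<Sum>g\<in>keys v. lookup (lookup v g) 0 * lookup (\<rho> g) 0) \<noteq> 0" by simp
  then obtain g where "g \<in> keys v" "lookup (lookup v g) 0 * lookup (\<rho> g) 0 \<noteq> 0"
    by (rule sum.not_neutral_contains_not_neutral)
  then have "g \<in> keys v" and g0: "lookup (\<rho> g) 0 \<noteq> 0" by auto
  with v have g: "g \<in> gens (b 0)" by (auto simp: fcar_def)
  have fst0: "fst g = 0"
    using \<rho>(1)[OF g] g0 unfolding homogeneous_part_iff by (metis mdeg_0 of_nat_0)
  have "h = g" if h: "h \<in> gens (b 0)" for h
  proof (rule ccontr)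
    assume "h \<noteq> g"
    \<comment> \<open>The Koszul relation between \<open>g\<close> and \<open>h\<close>: it lies in
      the kernel, yet its coefficient at \<open>h\<close> is \<open>\<rho> g\<close>, whose constant
      term is nonzero.\<close>
    define w where "w = single h (\<rho> g) + single g (- \<rho> h)"
    have w: "w \<in> fcar (b 0)"
      using g h by (simp add: w_def fcar_add fcar_single)
    have "L w = 0" by (simp add: L w_def lin_add lookup_add)
    then have "lookup (lookup w h) 0 = 0"
      using w by (intro min) (simp_all add: kerL ideal_module_subspace)
    with \<open>h \<noteq> g\<close> g0 show False by (simp add: w_def lookup_add lookup_single)
  qed
  with g have "gens (b 0) = {g}" by blast
  also have "g = (0, snd g)" using fst0 by (simp add: prod_eq_iff)
  finally have "gens (b 0) = {(0, snd g)}" .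
  from rank_eq_unit_rank[OF this] have b0: "b 0 = unit_rank" and g00: "g = (0, 0)"
    using fst0 by (auto simp: prod_eq_iff)
  show "b 0 = unit_rank" by (fact b0)
  \<comment> \<open>\<open>g\<close> has degree 0, so its representative is a nonzero constant, and
    on this module \<open>L\<close> is multiplication by it.\<close>
  define c where "c = lookup (\<rho> g) 0"
  have \<rho>g: "\<rho> g = single 0 c"
    using \<rho>(1)[OF g] fst0 unfolding homogeneous_part_iff c_def
    by (intro poly_mapping_eqI) (auto simp: lookup_single when_def)
  have "L v \<in> I \<longleftrightarrow> lookup v (0, 0) \<in> I" if "v \<in> fcar unit_rank" for v
  proof -
    have "v = emb (lookup v (0, 0))" using that by (simp add: fcar_unit_rank)
    then have "L v = lookup (lin (\<lambda>g. emb (\<rho> g)) (emb (lookup v (0, 0)))) (0, 0)"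
      unfolding L by simp
    then have Lv: "L v = lookup v (0, 0) * single 0 c"
      using \<rho>g g00 by simp
    have "single 0 (inverse c) * L v = (single 0 (inverse c) * single 0 c) * lookup v (0, 0)"
      unfolding Lv by (simp only: mult_ac)
    also have "single 0 (inverse c) * single 0 c = (1 :: ('n, 'k) mpoly)"
      using g0 by (simp add: mult_single c_def)
    finally have vL: "lookup v (0, 0) = single 0 (inverse c) * L v" by simp
    show ?thesis
    proof
      assume "L v \<in> I"
      then show "lookup v (0, 0) \<in> I" by (subst vL) (rule ideal_module_subspace(3))
    next
      assume "lookup v (0, 0) \<in> I"
      then show "L v \<in> I" unfolding Lv by (subst mult.commute) (rule ideal_module_subspace(3))
    qed
  qed
  then show "{v \<in> fcar (b 0). \<epsilon> v = I} = emb ` I"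
    using kerL unfolding set_eq_iff emb_image_iff b0 by blast
qed

lemma quotient_resolution_iff:
  assumes max: "\<forall>p\<in>I. lookup p 0 = 0"
  shows "(\<exists>\<epsilon> \<delta>. minimal_graded_free_resolution (quotient_gmodule I) b \<epsilon> \<delta>) \<longleftrightarrow>
    b 0 = unit_rank \<and> (\<exists>\<Phi>. augmented_resolution b \<Phi> (emb ` I))"
proof
  assume "\<exists>\<epsilon> \<delta>. minimal_graded_free_resolution (quotient_gmodule I) b \<epsilon> \<delta>"
  then obtain \<epsilon> \<delta> where res: "minimal_graded_free_resolution (quotient_gmodule I) b \<epsilon> \<delta>" by blast
  note r = res[unfolded minimal_graded_free_resolution_def carrier_free_gmodule quotient_gmodule_simps]
  obtain \<Psi> where \<Psi>: "\<And>i. graded_matrix (b i) (\<Psi> i)"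
      "\<And>i v. v \<in> fcar (b (Suc i)) \<Longrightarrow> \<delta> i v = lin (\<Psi> i) v"
    using resolution_differentials[OF res] by blast
  have im: "lin (\<Psi> i) ` fcar (b (Suc i)) = \<delta> i ` fcar (b (Suc i))" for i
    by (simp add: \<Psi>(2))
  have "augmented_resolution b \<Psi> (emb ` I)"
    unfolding augmented_resolution_def
  proof (intro conjI allI ballI)
    show "lin (\<Psi> 0) ` fcar (b 1) = emb ` I"
      using r cyclic_resolution(2)[OF max res] im[of 0] by simp
    fix i
    show "graded_matrix (b i) (\<Psi> i)" by (rule \<Psi>)
    have "\<delta> (Suc i) ` fcar (b (Suc (Suc i))) = {v \<in> fcar (b (Suc i)). \<delta> i v = 0}" using r by simp
    also have "\<dots> = {v \<in> fcar (b (Suc i)). lin (\<Psi> i) v = 0}" using \<Psi>(2) by auto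
    finally show "lin (\<Psi> (Suc i)) ` fcar (b (Suc (Suc i))) = {v \<in> fcar (b (Suc i)). lin (\<Psi> i) v = 0}"
      by (simp add: im)
    fix v :: "('n, 'k) fmod" and g assume v: "v \<in> fcar (b (Suc (Suc i)))"
    then show "lookup (lookup (lin (\<Psi> (Suc i)) v) g) 0 = 0"
      using r by (simp add: \<Psi>(2)[OF v, symmetric])
  qed
  with cyclic_resolution(1)[OF max res] show "b 0 = unit_rank \<and> (\<exists>\<Phi>. augmented_resolution b \<Phi> (emb ` I))"
    by blast
next
  assume "b 0 = unit_rank \<and> (\<exists>\<Phi>. augmented_resolution b \<Phi> (emb ` I))"
  then obtain \<Phi> where b0: "b 0 = unit_rank" and res: "augmented_resolution b \<Phi> (emb ` I)" by blast
  have gr: "\<And>i. graded_matrix (b i) (\<Phi> i)"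
    and im: "lin (\<Phi> 0) ` fcar (b 1) = emb ` I"
    and ex: "\<And>i. lin (\<Phi> (Suc i)) ` fcar (b (Suc (Suc i))) = {v \<in> fcar (b (Suc i)). lin (\<Phi> i) v = 0}"
    and min: "\<And>i v g. v \<in> fcar (b (Suc (Suc i))) \<Longrightarrow> lookup (lookup (lin (\<Phi> (Suc i)) v) g) 0 = 0"
    using res unfolding augmented_resolution_def by auto
  define \<epsilon> where "\<epsilon> v = residue_class I (lookup v (0, 0))" for v :: "('n, 'k) fmod"
  have surj: "\<epsilon> ` fcar unit_rank = range (residue_class I)"
  proof -
    have "residue_class I p = \<epsilon> (emb p)" for p by (simp add: \<epsilon>_def)
    then show ?thesis using emb_fcar unfolding \<epsilon>_def by blast
  qed
  have "lookup v (0, 0) \<in> homogeneous_part e" if "v \<in> fdeg e" for v :: "('n, 'k) fmod" and e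
    using that by (metis (no_types, lifting) diff_zero fdeg_def fst_conv mem_Collect_eq)
  then have \<epsilon>h: "\<epsilon> \<in> graded_hom (free_gmodule (b 0)) (quotient_gmodule I)"
    by (auto simp: graded_hom_def carrier_free_gmodule grade_free_gmodule \<epsilon>_def lookup_add quotient_gmodule_simps)
  have ker: "{v \<in> fcar unit_rank. \<epsilon> v = I} = emb ` I"
    using residue_class_eq_iff[of _ 0] unfolding set_eq_iff emb_image_iff \<epsilon>_def residue_class_zero by simp
  \<comment> \<open>\<open>augmented_resolution\<close> leaves the minimality of
    \<open>\<Phi> 0\<close> open; its image is \<open>I\<close>, which \<open>max\<close> puts into
    the maximal ideal.\<close>
  have min': "lookup (lookup (lin (\<Phi> i) v) g) 0 = 0" if v: "v \<in> fcar (b (Suc i))" for i v g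
  proof (cases i)
    case 0
    have "lin (\<Phi> 0) v \<in> emb ` I" using im v 0 by auto
    then show ?thesis using max 0 by (auto simp: lookup_single when_def)
  next
    case (Suc l)
    then show ?thesis using min v by blast
  qed
  have "minimal_graded_free_resolution (quotient_gmodule I) b \<epsilon> (\<lambda>i. lin (\<Phi> i))"
    unfolding minimal_graded_free_resolution_def carrier_free_gmodule quotient_gmodule_simps
    using \<epsilon>h surj ker im ex min' lin_graded_hom[OF gr] by (simp add: b0)
  then show "\<exists>\<epsilon> \<delta>. minimal_graded_free_resolution (quotient_gmodule I) b \<epsilon> \<delta>" by blast
qed

end

section \<open>Existence of minimal resolutions\<close>

abbreviation kscale :: "'k \<Rightarrow> ('n::finite, 'k::field) fmod \<Rightarrow> ('n, 'k) fmod" where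
  "kscale c \<equiv> pscale (single 0 c)"

text \<open>Graded pieces are in general not closed under \<open>R\<close>; dimension counts use the
  action of \<open>K\<close> through constant polynomials.\<close>

interpretation kv: vector_space "kscale :: 'k \<Rightarrow> ('n::finite, 'k::field) fmod \<Rightarrow> _"
  by unfold_locales
     (simp_all add: pm.scale_right_distrib pm.scale_left_distrib single_add mult_single)

lemma pm_subspace_imp_kv_subspace: "pm.subspace S \<Longrightarrow> kv.subspace S"
  by (simp add: pm.subspace_def kv.subspace_def)

lemma kv_subspace_fdeg: "kv.subspace (fdeg e)"
  using fdeg_zero fdeg_add fdeg_pscale[OF homogeneous_part_single[THEN iffD2], of _ 0 0]
  unfolding kv.subspace_def by simp blast

text \<open>A basis of \<open>S\<close> modulo \<open>W\<close>, phrased without a quotient space: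
  extend a basis of \<open>W\<close> to one of \<open>S\<close> and keep the new vectors. A
  combination of them in \<open>W\<close> with a nonzero coefficient would make the extended basis
  dependent.\<close>

lemma (in vector_space) relative_basis_exists:
  assumes "subspace W" "subspace S" "W \<subseteq> S" "S \<subseteq> span T" "finite T"
  shows "\<exists>C. finite C \<and> C \<subseteq> S \<and> S \<subseteq> span (W \<union> C) \<and>
    (\<forall>f. (\<Sum>c\<in>C. f c *s c) \<in> W \<longrightarrow> (\<forall>c\<in>C. f c = 0))"
proof -
  obtain B where B: "B \<subseteq> W" "independent B" "W \<subseteq> span B"
    by (rule maximal_independent_subset)
  obtain D where D: "B \<subseteq> D" "D \<subseteq> S" "independent D" "S \<subseteq> span D"
    by (rule maximal_independent_subset_extend[OF subset_trans[OF B(1) assms(3)] B(2)])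
  have "finite D"
    using independent_span_bound[OF \<open>finite T\<close> D(3)] D(2) assms(4) by blast
  show ?thesis
  proof (intro exI[of _ "D - B"] conjI allI impI ballI)
    show "finite (D - B)" "D - B \<subseteq> S" using \<open>finite D\<close> D by auto
    show "S \<subseteq> span (W \<union> (D - B))"
      using D(4) span_mono[of D "W \<union> (D - B)"] B(1) by blast
    fix f c assume sum: "(\<Sum>c\<in>D - B. f c *s c) \<in> W" and c: "c \<in> D - B"
    show "f c = 0"
    proof (rule ccontr)
      assume "f c \<noteq> 0"
      let ?X = "span (D - {c})"
      have "(\<Sum>c\<in>D - B. f c *s c) = f c *s c + (\<Sum>c\<in>D - B - {c}. f c *s c)"
        using \<open>finite D\<close> c by (simp add: sum.remove)
      moreover have "(\<Sum>c\<in>D - B. f c *s c) \<in> ?X"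
        using sum B(3) span_mono[of B "D - {c}"] D(1) c by blast
      moreover have "(\<Sum>c\<in>D - B - {c}. f c *s c) \<in> ?X"
        by (intro span_sum span_scale span_base) auto
      ultimately have "f c *s c \<in> ?X"
        using span_diff[of "\<Sum>c\<in>D - B. f c *s c" "D - {c}" "\<Sum>c\<in>D - B - {c}. f c *s c"] by simp
      then have "inverse (f c) *s (f c *s c) \<in> ?X" by (rule span_scale)
      then have "c \<in> ?X" using \<open>f c \<noteq> 0\<close> by simp
      with D(3) c show False by (auto simp: dependent_def)
    qed
  qed
qed

lemma finite_mdeg: "finite {m :: 'n::finite \<Rightarrow>\<^sub>0 nat. mdeg m = d}"
proof (rule finite_imageD)
  have "lookup m i \<le> mdeg m" for m :: "'n \<Rightarrow>\<^sub>0 nat" and i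
    by (simp add: mdeg_def member_le_sum)
  then have "lookup ` {m :: 'n \<Rightarrow>\<^sub>0 nat. mdeg m = d} \<subseteq> PiE UNIV (\<lambda>_. {..d})"
    by auto
  then show "finite (lookup ` {m :: 'n \<Rightarrow>\<^sub>0 nat. mdeg m = d})"
    by (rule finite_subset) (simp add: finite_PiE)
qed (simp add: inj_on_def poly_mapping.lookup_inject)

lemma homogeneous_part_0_eq:
  assumes "p \<in> homogeneous_part 0"
  shows "p = single 0 (lookup p 0)"
proof (rule poly_mapping_eqI)
  fix m show "lookup p m = lookup (single 0 (lookup p 0)) m"
    using assms by (cases "m = 0") (auto simp: homogeneous_part_iff lookup_single)
qed

lemma fdeg_keys_le:
  assumes "v \<in> fdeg e" "g \<in> keys v"
  shows "fst g \<le> e"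
proof -
  have "lookup v g \<noteq> 0" using assms by (simp add: in_keys_iff)
  then obtain m where "lookup (lookup v g) m \<noteq> 0"
    by (metis lookup_zero poly_mapping_eqI)
  moreover have "lookup v g \<in> homogeneous_part (e - fst g)"
    using assms by (simp add: fdeg_def)
  ultimately have "int (mdeg m) = e - fst g" by (simp add: homogeneous_part_iff)
  then show ?thesis by simp
qed

text \<open>Generator times monomial of total degree \<open>e\<close>: the index set of the monomial
  basis of a graded piece over \<open>K\<close>.\<close>

definition term_index :: "(int \<Rightarrow> nat) \<Rightarrow> int \<Rightarrow> ((int \<times> nat) \<times> ('n::finite \<Rightarrow>\<^sub>0 nat)) set" where
  "term_index b e = {(g, m). g \<in> gens b \<and> fst g + int (mdeg m) = e}"

definition term_of :: "(int \<times> nat) \<times> ('n::finite \<Rightarrow>\<^sub>0 nat) \<Rightarrow> ('n, 'k::field) fmod" where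
  "term_of x = single (fst x) (single (snd x) 1)"

lemma finite_term_index:
  assumes "finite {g \<in> gens b. fst g \<le> e}"
  shows "finite (term_index b e :: ((int \<times> nat) \<times> ('n::finite \<Rightarrow>\<^sub>0 nat)) set)"
proof (rule finite_subset)
  show "term_index b e \<subseteq> Sigma {g \<in> gens b. fst g \<le> e} (\<lambda>g. {m. mdeg m = nat (e - fst g)})"
    by (auto simp: term_index_def)
  show "finite (Sigma {g \<in> gens b. fst g \<le> e} (\<lambda>g. {m :: 'n \<Rightarrow>\<^sub>0 nat. mdeg m = nat (e - fst g)}))"
    using assms finite_mdeg by blast
qed

text \<open>Degrees are bounded below and each carries finitely many generators, so graded pieces
  are finite-dimensional even if the total rank is infinite.\<close>

lemma finite_gens_le:
  assumes "\<And>j. j < 0 \<Longrightarrow> b j = 0"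
  shows "finite {g \<in> gens b. fst g \<le> e}"
proof (rule finite_subset)
  show "{g \<in> gens b. fst g \<le> e} \<subseteq> (SIGMA j:{0..e}. {..<b j})"
    using assms by (force simp: gens_def not_le[symmetric])
qed auto

lemma fcar_fdeg_span:
  assumes "v \<in> fcar b" "v \<in> fdeg e"
  shows "v \<in> kv.span (term_of ` term_index b e)"
proof -
  have "single g (lookup v g) \<in> kv.span (term_of ` term_index b e)" if g: "g \<in> keys v" for g
  proof -
    have "single g (lookup v g) = (\<Sum>m\<in>keys (lookup v g). single g (single m (lookup (lookup v g) m)))"
      by (subst poly_mapping_eq_sum_single[of "lookup v g"])
        (rule poly_mapping_eqI, simp add: lookup_sum lookup_single when_def)
    also have "\<dots> = (\<Sum>m\<in>keys (lookup v g). kscale (lookup (lookup v g) m) (term_of (g, m)))"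
      by (simp add: term_of_def mult_single)
    also have "\<dots> \<in> kv.span (term_of ` term_index b e)"
    proof (intro kv.span_sum kv.span_scale kv.span_base imageI)
      fix m assume "m \<in> keys (lookup v g)"
      then show "(g, m) \<in> term_index b e"
        using assms g by (auto simp: term_index_def fcar_def fdeg_def homogeneous_part_iff in_keys_iff subset_iff)
    qed
    finally show ?thesis .
  qed
  then show ?thesis
    by (subst poly_mapping_eq_sum_single[of v]) (rule kv.span_sum)
qed

lemma fpart_sum_decomposition: "\<exists>E. finite E \<and> v = (\<Sum>e\<in>E. fpart e v)"
proof (intro exI conjI)
  let ?E = "\<Union>g\<in>keys v. (\<lambda>m. fst g + int (mdeg m)) ` keys (lookup v g)"
  show fin: "finite ?E" by simp
  show "v = (\<Sum>e\<in>?E. fpart e v)"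
  proof (intro poly_mapping_eqI)
    fix g m
    show "lookup (lookup v g) m = lookup (lookup (\<Sum>e\<in>?E. fpart e v) g) m"
    proof (cases "lookup (lookup v g) m = 0")
      case True
      then show ?thesis by (simp add: lookup_sum)
    next
      case False
      then have "m \<in> keys (lookup v g)" "g \<in> keys v" by (auto simp: in_keys_iff)
      then have "fst g + int (mdeg m) \<in> ?E" by blast
      moreover have "lookup (lookup (\<Sum>e\<in>?E. fpart e v) g) m
          = (\<Sum>e\<in>?E. if e = fst g + int (mdeg m) then lookup (lookup v g) m else 0)"
        unfolding lookup_sum by (intro sum.cong) (auto simp: when_def)
      ultimately show ?thesis using fin by simp
    qed
  qed
qed

section \<open>Minimal covers of graded submodules\<close>

definition graded_submodule :: "(int \<Rightarrow> nat) \<Rightarrow> ('n::finite, 'k::field) fmod set \<Rightarrow> bool" where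
  "graded_submodule b N \<longleftrightarrow> pm.subspace N \<and> N \<subseteq> fcar b \<and> (\<forall>v\<in>N. \<forall>e. fpart e v \<in> N)"

lemma graded_submodule_kernel:
  assumes "graded_matrix c \<phi>"
  shows "graded_submodule b {v \<in> fcar b. lin \<phi> v = 0}"
  unfolding graded_submodule_def pm.subspace_def
  using fpart_lin[OF assms, symmetric]
  by (auto simp: lin_add lin_pscale fcar_add fcar_pscale fpart_fcar)

text \<open>
  New generators in degree \<open>e\<close> are chosen as a basis of \<open>N\<^sub>e\<close> modulo the part \<open>W e\<close> generated in lower
  degrees. This gives minimality without mentioning the maximal ideal.
\<close>

lemma minimal_cover_exists:
  fixes N :: "('n::finite, 'k::field) fmod set"
  assumes b: "\<And>j. j < 0 \<Longrightarrow> b j = 0" and N: "graded_submodule b N"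
  shows "\<exists>b' \<phi>. (\<forall>j<0. b' j = 0) \<and> graded_matrix b \<phi> \<and> lin \<phi> ` fcar b' = N \<and>
    (\<forall>v\<in>fcar b'. lin \<phi> v = 0 \<longrightarrow> (\<forall>g. lookup (lookup v g) 0 = 0))"
proof -
  have Nsub: "pm.subspace N" and Nb: "N \<subseteq> fcar b" and Npart: "\<And>v e. v \<in> N \<Longrightarrow> fpart e v \<in> N"
    using N by (auto simp: graded_submodule_def)
  have sub: "kv.subspace (N \<inter> fdeg e)" for e
    by (intro kv.subspace_inter pm_subspace_imp_kv_subspace Nsub kv_subspace_fdeg)
  define L where "L e = pm.span (\<Union>e'<e. N \<inter> fdeg e')" for e
  define W where "W e = N \<inter> fdeg e \<inter> L e" for e
  have "kv.subspace (W e)" for e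
    unfolding W_def L_def by (intro kv.subspace_inter[OF sub] pm_subspace_imp_kv_subspace pm.subspace_span)
  moreover have "N \<inter> fdeg e \<subseteq> kv.span (term_of ` term_index b e)" for e
    using fcar_fdeg_span Nb by blast
  moreover have "finite (term_of ` term_index b e)" for e
    using finite_term_index[OF finite_gens_le] b by blast
  ultimately have "\<forall>e. \<exists>C. finite C \<and> C \<subseteq> N \<inter> fdeg e \<and> N \<inter> fdeg e \<subseteq> kv.span (W e \<union> C) \<and>
      (\<forall>f. (\<Sum>c\<in>C. kscale (f c) c) \<in> W e \<longrightarrow> (\<forall>c\<in>C. f c = 0))"
    by (intro allI kv.relative_basis_exists[OF _ sub]) (auto simp: W_def)
  from choice[OF this] obtain C where C: "\<forall>e. finite (C e) \<and> C e \<subseteq> N \<inter> fdeg e \<and>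
      N \<inter> fdeg e \<subseteq> kv.span (W e \<union> C e) \<and>
      (\<forall>f. (\<Sum>c\<in>C e. kscale (f c) c) \<in> W e \<longrightarrow> (\<forall>c\<in>C e. f c = 0))" ..
  have fin: "\<And>e. finite (C e)" and CN: "\<And>e. C e \<subseteq> N \<inter> fdeg e"
    and gen: "\<And>e. N \<inter> fdeg e \<subseteq> kv.span (W e \<union> C e)"
    using C by simp_all
  have ind: "f c = 0" if "(\<Sum>c\<in>C e. kscale (f c) c) \<in> W e" "c \<in> C e" for e f c
    using C that by blast
  have "\<forall>e. \<exists>h. bij_betw h {..<card (C e)} (C e)"
    using ex_bij_betw_nat_finite[OF fin] by (simp add: atLeast0LessThan)
  from choice[OF this] obtain h where h: "\<And>e. bij_betw (h e) {..<card (C e)} (C e)" by blast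
  define b' where "b' e = card (C e)" for e
  define \<phi> where "\<phi> g = (if g \<in> gens b' then h (fst g) (snd g) else 0)" for g
  have \<phi>C: "\<phi> g \<in> C (fst g)" if "g \<in> gens b'" for g
    using that bij_betwE[OF h[of "fst g"]] by (auto simp: \<phi>_def gens_def b'_def)
  have \<phi>N: "\<phi> g \<in> N \<inter> fdeg (fst g)" for g
    using \<phi>C[of g] CN pm.subspace_0[OF Nsub] by (cases "g \<in> gens b'") (auto simp: \<phi>_def)
  \<comment> \<open>Nonnegative generator degrees leave no nonzero vector of negative degree; this
    grounds the induction on the degree further down.\<close>
  have neg: "N \<inter> fdeg e = {0}" if "e < 0" for e
  proof -
    have "v = 0" if v: "v \<in> N \<inter> fdeg e" for v
    proof (rule poly_mapping_eqI, rule ccontr)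
      fix g assume *: "lookup v g \<noteq> lookup 0 g"
      moreover have "v \<in> fcar b" using v Nb by blast
      ultimately have "g \<in> gens b" by (auto simp: fcar_def in_keys_iff subset_iff)
      then have "fst g \<ge> 0" using b by (force simp: gens_def not_le[symmetric])
      moreover have "fst g \<le> e" using v * by (intro fdeg_keys_le) (auto simp: in_keys_iff)
      ultimately show False using \<open>e < 0\<close> by simp
    qed
    then show ?thesis using pm.subspace_0[OF Nsub] by auto
  qed
  have "b' j = 0" if "j < 0" for j
  proof -
    have "C j \<subseteq> {0}" using CN[of j] neg[OF that] by simp
    \<comment> \<open>A vector 0 in \<open>C j\<close> would be a relation modulo \<open>W j\<close>
      with coefficient 1.\<close>
    moreover have "0 \<notin> C j"
    proof
      assume "0 \<in> C j"
      then have "C j = {0}" using \<open>C j \<subseteq> {0}\<close> by blast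
      then show False using ind[of "\<lambda>_. 1" j 0] pm.subspace_0[OF Nsub]
        by (simp add: W_def L_def pm.span_zero)
    qed
    ultimately have "C j = {}" by blast
    then show ?thesis by (simp add: b'_def)
  qed
  moreover have gr: "graded_matrix b \<phi>"
    using \<phi>N Nb by (auto simp: graded_matrix_def)
  moreover have "lin \<phi> ` fcar b' = N"
  proof
    show "lin \<phi> ` fcar b' \<subseteq> N"
      using \<phi>N by (auto simp: lin_def intro!: pm.subspace_sum[OF Nsub] pm.subspace_scale[OF Nsub])
    have im: "pm.subspace (lin \<phi> ` fcar b')"
      by (rule module_hom.subspace_image[OF lin_module_hom fcar_subspace])
    \<comment> \<open>\<open>L (int n)\<close> is generated in lower degrees, hence in the image by
      induction; the chosen vectors \<open>C (int n)\<close> account for the rest of that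
      degree.\<close>
    have step: "N \<inter> fdeg (int n) \<subseteq> lin \<phi> ` fcar b'" for n
    proof (induction n rule: less_induct)
      case (less n)
      have "N \<inter> fdeg e' \<subseteq> lin \<phi> ` fcar b'" if "e' < int n" for e'
      proof (cases "e' < 0")
        case True
        then show ?thesis using neg pm.subspace_0[OF im] by simp
      next
        case False
        then show ?thesis using less[of "nat e'"] that by simp
      qed
      then have "L (int n) \<subseteq> lin \<phi> ` fcar b'"
        unfolding L_def by (intro pm.span_minimal im) auto
      moreover have "c \<in> lin \<phi> ` fcar b'" if "c \<in> C (int n)" for c
      proof -
        have "c \<in> h (int n) ` {..<card (C (int n))}"
          using that h[of "int n"] by (simp add: bij_betw_def)
        then obtain k where k: "k < b' (int n)" "c = h (int n) k"
          by (auto simp: b'_def)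
        then have "(int n, k) \<in> gens b'" by (simp add: gens_def)
        then have "c = lin \<phi> (single (int n, k) 1)" "single (int n, k) 1 \<in> fcar b'"
          using k by (simp_all add: \<phi>_def fcar_single)
        then show ?thesis by blast
      qed
      ultimately have "kv.span (W (int n) \<union> C (int n)) \<subseteq> lin \<phi> ` fcar b'"
        by (intro kv.span_minimal pm_subspace_imp_kv_subspace im) (auto simp: W_def)
      then show ?case using gen[of "int n"] by blast
    qed
    have "N \<inter> fdeg e \<subseteq> lin \<phi> ` fcar b'" for e
      using step[of "nat e"] neg[of e] pm.subspace_0[OF im] by (cases "e < 0") auto
    then have "fpart e v \<in> lin \<phi> ` fcar b'" if "v \<in> N" for v e
      using Npart[OF that] fpart_fdeg by blast
    then show "N \<subseteq> lin \<phi> ` fcar b'"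
      using fpart_sum_decomposition pm.subspace_sum[OF im] by (metis subsetI)
  qed
  moreover have "lookup (lookup v g) 0 = 0" if v: "v \<in> fcar b'" "lin \<phi> v = 0" for v g
  proof (cases "g \<in> gens b'")
    case False
    then have "lookup v g = 0" using v(1) by (auto simp: fcar_def in_keys_iff subset_iff)
    then show ?thesis by simp
  next
    case g: True
    \<comment> \<open>To test the coefficient at \<open>g\<close>, pass to the component
      \<open>u\<close> of the relation in the degree \<open>j\<close> of \<open>g\<close>. In it,
      generators of degree above \<open>j\<close> do not occur, those of degree \<open>j\<close>
      have constant coefficients, and those of lower degree contribute an element of
      \<open>L j\<close>.\<close>
    define j where "j = fst g"
    define u where "u = fpart j v"
    have u: "u \<in> fcar b'" "u \<in> fdeg j" "lin \<phi> u = 0"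
      using v fpart_fcar fpart_fdeg fpart_lin[OF gr, of j v] by (auto simp: u_def)
    have u0: "lookup u q = single 0 (lookup (lookup u q) 0)" if "fst q = j" for q
    proof (rule homogeneous_part_0_eq)
      have "lookup u q \<in> homogeneous_part (j - fst q)" using u(2) by (simp add: fdeg_def)
      then show "lookup u q \<in> homogeneous_part 0" using that by simp
    qed
    let ?T = "(\<lambda>k. (j, k)) ` {..<b' j}"
    have "q \<in> ?T" if "q \<in> keys u" "\<not> fst q < j" for q
      using fdeg_keys_le[OF u(2) that(1)] that u(1) by (cases q) (auto simp: fcar_def gens_def)
    then have keys: "keys u \<subseteq> {q \<in> keys u. fst q < j} \<union> ?T" by blast
    have "0 = (\<Sum>q\<in>{q \<in> keys u. fst q < j} \<union> ?T. pscale (lookup u q) (\<phi> q))"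
      by (subst lin_superset[OF _ keys, symmetric]) (simp_all add: u(3))
    also have "\<dots> = (\<Sum>q\<in>{q \<in> keys u. fst q < j}. pscale (lookup u q) (\<phi> q)) + (\<Sum>q\<in>?T. pscale (lookup u q) (\<phi> q))"
      by (intro sum.union_disjoint) auto
    finally have eq: "(\<Sum>q\<in>?T. pscale (lookup u q) (\<phi> q)) = - (\<Sum>q\<in>{q \<in> keys u. fst q < j}. pscale (lookup u q) (\<phi> q))"
      by (simp add: eq_neg_iff_add_eq_0 add.commute)
    have "(\<Sum>q\<in>{q \<in> keys u. fst q < j}. pscale (lookup u q) (\<phi> q)) \<in> L j"
      unfolding L_def using \<phi>N by (intro pm.span_sum pm.span_scale pm.span_base) auto
    then have inL: "(\<Sum>q\<in>?T. pscale (lookup u q) (\<phi> q)) \<in> L j"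
      unfolding eq L_def by (rule pm.span_neg)
    \<comment> \<open>Carries the constant coefficients over from the numbering of the generators to
      the set \<open>C j\<close>, whose independence modulo \<open>W j\<close> then makes them
      vanish.\<close>
    define f where "f c = lookup (lookup u (j, inv_into {..<b' j} (h j) c)) 0" for c
    have hinj: "inj_on (h j) {..<b' j}" and him: "h j ` {..<b' j} = C j"
      using h[of j] by (auto simp: bij_betw_def b'_def)
    have "(\<Sum>q\<in>?T. pscale (lookup u q) (\<phi> q)) = (\<Sum>k<b' j. pscale (lookup u (j, k)) (\<phi> (j, k)))"
      by (subst sum.reindex) (auto simp: inj_on_def)
    also have "\<dots> = (\<Sum>k<b' j. kscale (f (h j k)) (h j k))"
    proof (rule sum.cong)
      fix k assume k: "k \<in> {..<b' j}"
      then have "f (h j k) = lookup (lookup u (j, k)) 0" "\<phi> (j, k) = h j k"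
        by (simp_all add: f_def inv_into_f_f[OF hinj] \<phi>_def gens_def)
      then show "pscale (lookup u (j, k)) (\<phi> (j, k)) = kscale (f (h j k)) (h j k)"
        using u0[of "(j, k)"] by simp
    qed simp
    also have "\<dots> = (\<Sum>c\<in>C j. kscale (f c) c)"
      unfolding him[symmetric] by (simp add: sum.reindex[OF hinj])
    finally have eq': "(\<Sum>q\<in>?T. pscale (lookup u q) (\<phi> q)) = (\<Sum>c\<in>C j. kscale (f c) c)" .
    have "(\<Sum>c\<in>C j. kscale (f c) c) \<in> N \<inter> fdeg j"
      using CN by (intro kv.subspace_sum[OF sub] kv.subspace_scale[OF sub]) auto
    then have "(\<Sum>c\<in>C j. kscale (f c) c) \<in> W j"
      using inL by (simp add: W_def eq')
    moreover have gk: "snd g < b' j" using g by (auto simp: gens_def j_def)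
    then have "h j (snd g) \<in> C j" using him by blast
    ultimately have "f (h j (snd g)) = 0" by (rule ind)
    then have "lookup (lookup u g) 0 = 0"
      using inv_into_f_f[OF hinj, of "snd g"] gk by (simp add: f_def) (simp add: j_def)
    then show ?thesis by (simp add: u_def j_def)
  qed
  ultimately show ?thesis by blast
qed

text \<open>Cover \<open>N\<close>, pass to the kernel of the cover, and repeat. The kernel of a
  minimal cover has no constant parts and is the image of the next map, so minimality is obtained
  exactly where \<open>augmented_resolution\<close> asks for it.\<close>

lemma augmented_resolution_exists:
  fixes N :: "('n::finite, 'k::field) fmod set"
  assumes "\<And>j. j < 0 \<Longrightarrow> b j = 0" "graded_submodule b N"
  shows "\<exists>B \<Phi>. B 0 = b \<and> augmented_resolution B \<Phi> N"
proof -
  \<comment> \<open>A state is a rank function together with a graded submodule of its free module;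
    the clause for \<open>i = 0\<close> pins down the start.\<close>
  define P where "P i x \<longleftrightarrow> (\<forall>j<0. (fst x) j = 0) \<and> graded_submodule (fst x) (snd x) \<and> (i = 0 \<longrightarrow> x = (b, N))"
    for i :: nat and x
  define R where "R x y \<phi> \<longleftrightarrow> graded_matrix (fst x) \<phi> \<and> lin \<phi> ` fcar (fst y) = snd x \<and>
      snd y = {v \<in> fcar (fst y). lin \<phi> v = 0} \<and> (\<forall>v\<in>snd y. \<forall>g. lookup (lookup v g) 0 = 0)"
    for x y :: "(int \<Rightarrow> nat) \<times> ('n, 'k) fmod set" and \<phi>
  have "P 0 (b, N)" using assms by (simp add: P_def)
  moreover have "\<exists>y. P (Suc i) y \<and> Ex (R x y)" if "P i x" for i x
  proof -
    have "\<exists>b' \<phi>. (\<forall>j<0. b' j = 0) \<and> graded_matrix (fst x) \<phi> \<and> lin \<phi> ` fcar b' = snd x \<and>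
        (\<forall>v\<in>fcar b'. lin \<phi> v = 0 \<longrightarrow> (\<forall>g. lookup (lookup v g) 0 = 0))"
      using that by (intro minimal_cover_exists) (simp_all add: P_def)
    then obtain b' \<phi> where "\<forall>j<0. b' j = 0" "graded_matrix (fst x) \<phi>" "lin \<phi> ` fcar b' = snd x"
        "\<forall>v\<in>fcar b'. lin \<phi> v = 0 \<longrightarrow> (\<forall>g. lookup (lookup v g) 0 = 0)" by blast
    then have "P (Suc i) (b', {v \<in> fcar b'. lin \<phi> v = 0}) \<and> R x (b', {v \<in> fcar b'. lin \<phi> v = 0}) \<phi>"
      by (simp add: P_def R_def graded_submodule_kernel)
    then show ?thesis by blast
  qed
  ultimately obtain Y where Y: "\<And>i. P i (Y i)" "\<And>i. Ex (R (Y i) (Y (Suc i)))"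
    using dependent_nat_choice[of P "\<lambda>_ x y. Ex (R x y)"] by metis
  then have "\<forall>i. \<exists>\<phi>. R (Y i) (Y (Suc i)) \<phi>" by blast
  from choice[OF this] obtain \<Phi> where \<Phi>: "\<And>i. R (Y i) (Y (Suc i)) (\<Phi> i)" by blast
  have "Y 0 = (b, N)" using Y(1)[of 0] by (simp add: P_def)
  moreover have "augmented_resolution (\<lambda>i. fst (Y i)) \<Phi> (snd (Y 0))"
    unfolding augmented_resolution_def
  proof (intro conjI allI ballI)
    fix i g and v :: "('n, 'k) fmod"
    show "graded_matrix (fst (Y i)) (\<Phi> i)" "lin (\<Phi> 0) ` fcar (fst (Y 1)) = snd (Y 0)"
      using \<Phi>[of i] \<Phi>[of 0] by (simp_all add: R_def)
    show im: "lin (\<Phi> (Suc i)) ` fcar (fst (Y (Suc (Suc i)))) = {v \<in> fcar (fst (Y (Suc i))). lin (\<Phi> i) v = 0}"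
      using \<Phi>[of i] \<Phi>[of "Suc i"] by (simp add: R_def)
    assume "v \<in> fcar (fst (Y (Suc (Suc i))))"
    then have "lin (\<Phi> (Suc i)) v \<in> snd (Y (Suc i))"
      using \<Phi>[of "Suc i"] by (auto simp: R_def)
    then show "lookup (lookup (lin (\<Phi> (Suc i)) v) g) 0 = 0"
      using \<Phi>[of i] by (auto simp: R_def)
  qed
  ultimately show ?thesis by (intro exI[of _ "\<lambda>i. fst (Y i)"] exI[of _ \<Phi>]) simp
qed

section \<open>Hilbert functions\<close>

text \<open>
  The library proves this only for linearly ordered monomials, so a linear order is pulled back
  from exponent vectors indexed by \<open>nat\<close>.
\<close>

lemma mpoly_mult_nonzero:
  fixes f g :: "('n::finite, 'k::field) mpoly"
  assumes "f \<noteq> 0" "g \<noteq> 0"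
  shows "f * g \<noteq> 0"
proof -
  obtain \<iota> :: "'n \<Rightarrow> nat" where \<iota>: "inj \<iota>"
    using finite_imp_inj_to_nat_seg[of "UNIV :: 'n set"] by auto
  define w where "w m = (\<Sum>i\<in>UNIV. single (\<iota> i) (lookup m i))" for m :: "'n \<Rightarrow>\<^sub>0 nat"
  have w_add: "w (a + b) = w a + w b" for a b
    by (simp add: w_def lookup_add single_add sum.distrib)
  have "lookup (w m) (\<iota> i) = lookup m i" for m i
    using \<iota> by (simp add: w_def lookup_sum lookup_single when_def inj_eq)
  then have w_inj: "w a = w b \<Longrightarrow> a = b" for a b
    by (metis poly_mapping_eqI)
  have lead: "\<exists>a\<in>keys h. \<forall>a'\<in>keys h. a' \<noteq> a \<longrightarrow> w a' < w a" if "h \<noteq> 0" for h :: "('n, 'k) mpoly"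
  proof -
    have ne: "w ` keys h \<noteq> {}" using that by simp
    have "Max (w ` keys h) \<in> w ` keys h" using ne by (intro Max_in) auto
    then obtain a where a: "Max (w ` keys h) = w a" "a \<in> keys h" by (rule imageE)
    then have "w a' < w a" if "a' \<in> keys h" "a' \<noteq> a" for a'
      using Max_ge[of "w ` keys h" "w a'"] that w_inj[of a' a] by (auto simp: order_less_le)
    with a show ?thesis by blast
  qed
  obtain a where a: "a \<in> keys f" "\<And>a'. a' \<in> keys f \<Longrightarrow> a' \<noteq> a \<Longrightarrow> w a' < w a"
    using lead[OF assms(1)] by blast
  obtain b where b: "b \<in> keys g" "\<And>b'. b' \<in> keys g \<Longrightarrow> b' \<noteq> b \<Longrightarrow> w b' < w b"
    using lead[OF assms(2)] by blast
  \<comment> \<open>Without its leading term each factor has only smaller monomials, so in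
    \<open>f * g\<close> the monomial \<open>a + b\<close> arises from the two leading terms
    alone.\<close>
  define f' where "f' = f - single a (lookup f a)"
  define g' where "g' = g - single b (lookup g b)"
  have f': "w x < w a" if "x \<in> keys f'" for x
    using that a(2)[of x] by (auto simp: f'_def in_keys_iff lookup_minus lookup_single when_def split: if_splits)
  have g': "w x < w b" if "x \<in> keys g'" for x
    using that b(2)[of x] by (auto simp: g'_def in_keys_iff lookup_minus lookup_single when_def split: if_splits)
  have le: "w x \<le> w b" if "x \<in> keys g" for x
    using b(2)[OF that] by (cases "x = b") auto
  have "a + b \<notin> keys (single a (lookup f a) * g')"
  proof
    assume "a + b \<in> keys (single a (lookup f a) * g')"
    then obtain x y where "x \<in> keys (single a (lookup f a))" "y \<in> keys g'" "a + b = x + y"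
      using keys_mult by blast
    then have "b \<in> keys g'" by (auto split: if_splits)
    then show False using g' by blast
  qed
  moreover have "a + b \<notin> keys (f' * g)"
  proof
    assume "a + b \<in> keys (f' * g)"
    then obtain x y where xy: "x \<in> keys f'" "y \<in> keys g" "a + b = x + y"
      using keys_mult by blast
    then have "w x + w y < w a + w b" by (intro add_less_le_mono f' le)
    then show False using xy(3) by (metis w_add less_irrefl)
  qed
  moreover have "f * g = single a (lookup f a) * single b (lookup g b) + single a (lookup f a) * g' + f' * g"
    by (simp add: f'_def g'_def algebra_simps)
  ultimately have "lookup (f * g) (a + b) = lookup f a * lookup g b"
    by (simp add: lookup_add mult_single in_keys_iff)
  also have "\<dots> \<noteq> 0" using a(1) b(1) by (simp add: in_keys_iff)
  finally show ?thesis by auto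
qed

section \<open>Dimensions of graded pieces\<close>

lemma lookup_term_of: "lookup (lookup (term_of x) g) m = (1 when (g, m) = x)"
  by (cases x) (auto simp: term_of_def lookup_single when_def)

lemma term_of_inj: "inj (term_of :: _ \<Rightarrow> ('n::finite, 'k::field) fmod)"
proof (rule injI)
  fix x y :: "(int \<times> nat) \<times> ('n \<Rightarrow>\<^sub>0 nat)"
  assume "term_of x = (term_of y :: ('n, 'k) fmod)"
  then have "lookup (lookup (term_of x :: ('n, 'k) fmod) (fst x)) (snd x)
      = lookup (lookup (term_of y :: ('n, 'k) fmod) (fst x)) (snd x)" by simp
  then show "x = y" by (simp add: lookup_term_of when_def split: if_splits)
qed

lemma term_of_independent:
  assumes "finite A"
  shows "kv.independent (term_of ` A :: ('n::finite, 'k::field) fmod set)"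
proof (rule kv.independent_if_scalars_zero)
  fix f :: "('n, 'k) fmod \<Rightarrow> 'k" and v :: "('n, 'k) fmod"
  assume sum: "(\<Sum>v\<in>term_of ` A. kscale (f v) v) = 0" and "v \<in> term_of ` A"
  then obtain x where x: "x \<in> A" "v = term_of x" by blast
  have "0 = lookup (lookup (\<Sum>v\<in>term_of ` A. kscale (f v) v) (fst x)) (snd x)" by (simp add: sum)
  also have "\<dots> = (\<Sum>y\<in>A. lookup (lookup (kscale (f (term_of y)) (term_of y)) (fst x)) (snd x))"
    by (simp add: sum.reindex[OF inj_on_subset[OF term_of_inj]] lookup_sum)
  also have "\<dots> = (\<Sum>y\<in>A. if y = x then f v else 0)"
  proof (rule sum.cong)
    fix y
    have k: "kscale (f (term_of y)) (term_of y) = single (fst y) (single (snd y) (f (term_of y)))"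
      by (simp add: term_of_def mult_single)
    show "lookup (lookup (kscale (f (term_of y)) (term_of y)) (fst x)) (snd x) = (if y = x then f v else 0)"
      unfolding k x(2) by (cases y; cases x) (auto simp: lookup_single when_def)
  qed simp
  also have "\<dots> = f v" using assms x by simp
  finally show "f v = 0" by simp
qed (use assms in simp)

lemma dim_free_part:
  assumes "finite (term_index b e :: ((int \<times> nat) \<times> ('n::finite \<Rightarrow>\<^sub>0 nat)) set)"
  shows "kv.dim (fcar b \<inter> fdeg e :: ('n, 'k::field) fmod set) = card (term_index b e :: ((int \<times> nat) \<times> ('n \<Rightarrow>\<^sub>0 nat)) set)"
proof (rule kv.dim_unique)
  show "(term_of ` term_index b e :: ('n, 'k) fmod set) \<subseteq> fcar b \<inter> fdeg e"
    by (auto simp: term_index_def term_of_def intro!: fcar_single fdeg_single)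
       (auto simp: homogeneous_part_single)
  show "fcar b \<inter> fdeg e \<subseteq> (kv.span (term_of ` term_index b e) :: ('n, 'k) fmod set)"
    using fcar_fdeg_span by blast
  show "kv.independent (term_of ` term_index b e :: ('n, 'k) fmod set)"
    by (rule term_of_independent[OF assms])
  show "card (term_of ` term_index b e :: ('n, 'k) fmod set) = card (term_index b e :: ((int \<times> nat) \<times> ('n \<Rightarrow>\<^sub>0 nat)) set)"
    by (rule card_image[OF inj_on_subset[OF term_of_inj]]) simp
qed

text \<open>A basis of \<open>S\<close> modulo the kernel is mapped to a basis of the image. The
  ambient space is infinite-dimensional, so finiteness comes from the spanning set \<open>T\<close>
  of \<open>S\<close>.\<close>

lemma rank_nullity:
  assumes S: "kv.subspace S" and T: "S \<subseteq> kv.span T" "finite T"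
  shows "kv.dim S = kv.dim {v \<in> S. lin \<phi> v = 0} + kv.dim (lin \<phi> ` S)"
proof -
  define W where "W = {v \<in> S. lin \<phi> v = 0}"
  have W: "kv.subspace W"
    using S by (auto simp: W_def kv.subspace_def lin_add lin_pscale)
  have WS: "W \<subseteq> S" by (auto simp: W_def)
  obtain C where C: "finite C" "C \<subseteq> S" "S \<subseteq> kv.span (W \<union> C)"
      and ind: "\<And>f c. (\<Sum>c\<in>C. kscale (f c) c) \<in> W \<Longrightarrow> c \<in> C \<Longrightarrow> f c = 0"
    using kv.relative_basis_exists[OF W S WS T] by blast
  obtain B where B: "B \<subseteq> W" "kv.independent B" "W \<subseteq> kv.span B" "card B = kv.dim W"
    by (rule kv.basis_exists)
  have finB: "finite B"
    using kv.independent_span_bound[OF T(2) B(2)] B(1) WS T(1) by blast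
  have C_W: "c \<notin> W" if c: "c \<in> C" for c
  proof
    assume "c \<in> W"
    have "(\<Sum>x\<in>C. kscale (if x = c then 1 else 0) x) = (\<Sum>x\<in>C. if x = c then x else 0)"
      by (intro sum.cong) auto
    also have "\<dots> = c" using C(1) c by simp
    finally show False using ind[of "\<lambda>x. if x = c then 1 else 0" c] \<open>c \<in> W\<close> c by simp
  qed
  have disj: "B \<inter> C = {}" using C_W B(1) by blast
  have indBC: "kv.independent (B \<union> C)"
  proof (rule kv.independent_if_scalars_zero)
    fix f x assume "(\<Sum>x\<in>B \<union> C. kscale (f x) x) = 0" and x: "x \<in> B \<union> C"
    then have eq: "(\<Sum>x\<in>C. kscale (f x) x) = - (\<Sum>x\<in>B. kscale (f x) x)"
      using finB C(1) disj by (simp add: sum.union_disjoint eq_neg_iff_add_eq_0 add.commute)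
    have "(\<Sum>x\<in>B. kscale (f x) x) \<in> W"
      using B(1) by (intro kv.subspace_sum[OF W] kv.subspace_scale[OF W]) auto
    then have "(\<Sum>x\<in>C. kscale (f x) x) \<in> W" unfolding eq by (rule kv.subspace_neg[OF W])
    then have fC: "f c = 0" if "c \<in> C" for c using ind that by blast
    then have "(\<Sum>x\<in>B. kscale (f x) x) = 0" using eq by simp
    then show "f x = 0"
      using fC x kv.independentD[OF B(2) finB subset_refl] by blast
  qed (use finB C(1) in simp)
  have "S \<subseteq> kv.span (B \<union> C)"
  proof -
    have "W \<union> C \<subseteq> kv.span (B \<union> C)"
      using B(3) kv.span_mono[of B "B \<union> C"] kv.span_superset[of "B \<union> C"] by blast
    then have "kv.span (W \<union> C) \<subseteq> kv.span (B \<union> C)"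
      by (rule kv.span_minimal) (rule kv.subspace_span)
    with C(3) show ?thesis by blast
  qed
  then have "kv.dim S = card (B \<union> C)"
    using B(1) WS C(2) indBC by (intro kv.dim_unique[of "B \<union> C"]) auto
  also have "\<dots> = kv.dim W + card C"
    using finB C(1) disj B(4) by (simp add: card_Un_disjoint)
  also have "card C = kv.dim (lin \<phi> ` S)"
  proof (rule kv.dim_unique[symmetric])
    have zero: "f c = 0" if "(\<Sum>c\<in>C. kscale (f c) (lin \<phi> c)) = 0" "c \<in> C" for f c
    proof (rule ind)
      have "(\<Sum>c\<in>C. kscale (f c) c) \<in> S"
        using C(2) by (intro kv.subspace_sum[OF S] kv.subspace_scale[OF S]) auto
      then show "(\<Sum>c\<in>C. kscale (f c) c) \<in> W"
        using that(1) by (simp add: W_def lin_sum lin_pscale)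
    qed fact
    have inj: "inj_on (lin \<phi>) C"
    proof (rule inj_onI, rule ccontr)
      fix x y assume xy: "x \<in> C" "y \<in> C" "lin \<phi> x = lin \<phi> y" "x \<noteq> y"
      have "(\<Sum>c\<in>C. kscale (if c = x then 1 else if c = y then - 1 else 0) (lin \<phi> c))
          = (\<Sum>c\<in>C. (if c = x then lin \<phi> c else 0) - (if c = y then lin \<phi> c else 0))"
        using xy(4) by (intro sum.cong) (auto simp: single_uminus)
      also have "\<dots> = 0" using xy C(1) by (simp add: sum_subtractf)
      finally show False
        using zero[of "\<lambda>c. if c = x then 1 else if c = y then - 1 else 0" x] xy by simp
    qed
    show "kv.independent (lin \<phi> ` C)"
    proof (rule kv.independent_if_scalars_zero)
      fix f x assume "(\<Sum>x\<in>lin \<phi> ` C. kscale (f x) x) = 0" "x \<in> lin \<phi> ` C"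
      then show "f x = 0" using zero[of "\<lambda>c. f (lin \<phi> c)"] by (auto simp: sum.reindex[OF inj])
    qed (use C(1) in simp)
    show "card (lin \<phi> ` C) = card C" by (rule card_image[OF inj])
    show "lin \<phi> ` C \<subseteq> lin \<phi> ` S" using C(2) by blast
    have "kv.subspace {v. lin \<phi> v \<in> kv.span (lin \<phi> ` C)}"
      unfolding kv.subspace_def
      by (auto simp: lin_add lin_pscale kv.span_zero kv.span_add kv.span_scale)
    then have "kv.span (W \<union> C) \<subseteq> {v. lin \<phi> v \<in> kv.span (lin \<phi> ` C)}"
      by (intro kv.span_minimal) (auto simp: W_def kv.span_zero kv.span_base)
    with C(3) show "lin \<phi> ` S \<subseteq> kv.span (lin \<phi> ` C)" by blast
  qed
  finally show ?thesis by (simp add: W_def)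
qed

text \<open>Euler characteristic in internal degree \<open>e\<close>: rank-nullity for each
  differential, where exactness cancels each kernel against the next image.\<close>

lemma augmented_resolution_hilbert:
  fixes N :: "('n::finite, 'k::field) fmod set"
  defines "hilb b e \<equiv> int (card (term_index b e :: ((int \<times> nat) \<times> ('n \<Rightarrow>\<^sub>0 nat)) set))"
  assumes res: "augmented_resolution B \<Phi> N" and fin: "\<And>i. finite (gens (B i))"
    and zero: "\<And>i. i > t \<Longrightarrow> gens (B (Suc i)) = {}"
  shows "int (kv.dim (N \<inter> fdeg e)) = (\<Sum>i\<le>t. (-1) ^ i * hilb (B (Suc i)) e)"
proof -
  have gr: "\<And>i. graded_matrix (B i) (\<Phi> i)"
    and im: "lin (\<Phi> 0) ` fcar (B (Suc 0)) = N"
    and ex: "\<And>i. lin (\<Phi> (Suc i)) ` fcar (B (Suc (Suc i))) = {v \<in> fcar (B (Suc i)). lin (\<Phi> i) v = 0}"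
    using res by (simp_all add: augmented_resolution_def)
  define Z where "Z i = int (kv.dim {v \<in> fcar (B (Suc i)) \<inter> fdeg e. lin (\<Phi> i) v = 0})" for i
  have finT: "finite (term_index (B i) e :: ((int \<times> nat) \<times> ('n \<Rightarrow>\<^sub>0 nat)) set)" for i
    using fin[of i] by (intro finite_term_index) simp
  have sub: "kv.subspace (fcar b \<inter> fdeg e)" for b
    by (intro kv.subspace_inter pm_subspace_imp_kv_subspace fcar_subspace kv_subspace_fdeg)
  \<comment> \<open>A preimage of a vector of degree \<open>e\<close> may be projected to degree
    \<open>e\<close>, so exactness passes to graded pieces.\<close>
  have image: "lin (\<Phi> i) ` (fcar (B (Suc i)) \<inter> fdeg e) = lin (\<Phi> i) ` fcar (B (Suc i)) \<inter> fdeg e" for i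
  proof
    show "lin (\<Phi> i) ` (fcar (B (Suc i)) \<inter> fdeg e) \<subseteq> lin (\<Phi> i) ` fcar (B (Suc i)) \<inter> fdeg e"
      using lin_fdeg[OF gr] by blast
    show "lin (\<Phi> i) ` fcar (B (Suc i)) \<inter> fdeg e \<subseteq> lin (\<Phi> i) ` (fcar (B (Suc i)) \<inter> fdeg e)"
    proof
      fix w assume "w \<in> lin (\<Phi> i) ` fcar (B (Suc i)) \<inter> fdeg e"
      then obtain v where v: "v \<in> fcar (B (Suc i))" "w = lin (\<Phi> i) v" "w \<in> fdeg e" by blast
      then have "w = lin (\<Phi> i) (fpart e v)"
        using fpart_lin[OF gr, of e i v] fpart_id by metis
      then show "w \<in> lin (\<Phi> i) ` (fcar (B (Suc i)) \<inter> fdeg e)"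
        using v fpart_fcar fpart_fdeg by blast
    qed
  qed
  have rn: "hilb (B (Suc i)) e = Z i + int (kv.dim (lin (\<Phi> i) ` fcar (B (Suc i)) \<inter> fdeg e))" for i
  proof -
    have "kv.dim (fcar (B (Suc i)) \<inter> fdeg e :: ('n, 'k) fmod set) =
        kv.dim {v \<in> fcar (B (Suc i)) \<inter> fdeg e. lin (\<Phi> i) v = 0}
        + kv.dim (lin (\<Phi> i) ` (fcar (B (Suc i)) \<inter> fdeg e))"
    proof (rule rank_nullity[OF sub])
      show "fcar (B (Suc i)) \<inter> fdeg e \<subseteq> kv.span (term_of ` term_index (B (Suc i)) e)"
        using fcar_fdeg_span by blast
    qed (use finT in simp)
    then show ?thesis
      using dim_free_part[OF finT, where 'k = 'k] by (simp add: hilb_def Z_def image)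
  qed
  have "int (kv.dim (N \<inter> fdeg e)) = (\<Sum>i\<le>n. (-1) ^ i * hilb (B (Suc i)) e) + (-1) ^ Suc n * Z n" for n
  proof (induction n)
    case 0
    then show ?case using rn[of 0] im by simp
  next
    case (Suc n)
    have "{v \<in> fcar (B (Suc n)). lin (\<Phi> n) v = 0} \<inter> fdeg e = {v \<in> fcar (B (Suc n)) \<inter> fdeg e. lin (\<Phi> n) v = 0}"
      by blast
    then have "hilb (B (Suc (Suc n))) e = Z (Suc n) + Z n"
      using rn[of "Suc n"] ex[of n] by (simp add: Z_def)
    then show ?case using Suc by (simp add: algebra_simps)
  qed
  \<comment> \<open>One step beyond \<open>t\<close>, both the extra summand and the remaining
    kernel belong to a zero module.\<close>
  from this[of "Suc t"] have "int (kv.dim (N \<inter> fdeg e)) =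
      (\<Sum>i\<le>t. (-1) ^ i * hilb (B (Suc i)) e) + (-1) ^ Suc t * hilb (B (Suc (Suc t))) e + (-1) ^ Suc (Suc t) * Z (Suc t)"
    by simp
  moreover have "hilb (B (Suc (Suc t))) e = 0"
    using zero[of "Suc t"] by (simp add: hilb_def term_index_def)
  moreover have "Z (Suc t) = 0"
  proof -
    have "fcar (B (Suc (Suc t))) = ({0} :: ('n, 'k) fmod set)"
      using zero[of "Suc t"] by (auto simp: fcar_def)
    then have "{v \<in> fcar (B (Suc (Suc t))) \<inter> fdeg e. lin (\<Phi> (Suc t)) v = 0} \<subseteq> kv.span {}"
      by (auto simp: kv.span_zero)
    then have "kv.dim {v \<in> fcar (B (Suc (Suc t))) \<inter> fdeg e. lin (\<Phi> (Suc t)) v = 0} \<le> card ({} :: ('n, 'k) fmod set)"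
      by (rule kv.dim_le_card) simp
    then show ?thesis by (simp add: Z_def)
  qed
  ultimately show ?thesis by simp
qed

section \<open>Growth of the Hilbert function of the polynomial ring\<close>

definition monomial_count :: "'n::finite itself \<Rightarrow> int \<Rightarrow> nat" where
  "monomial_count _ e = card {m :: 'n \<Rightarrow>\<^sub>0 nat. int (mdeg m) = e}"

text \<open>For \<open>e < a\<close> both sides are 0, since \<open>monomial_count\<close> takes an
  integer and counts nothing in negative degrees.\<close>

lemma card_term_index:
  assumes "\<And>j. b j = (if j = a then \<beta> else 0)"
  shows "card (term_index b e :: ((int \<times> nat) \<times> ('n::finite \<Rightarrow>\<^sub>0 nat)) set) = \<beta> * monomial_count TYPE('n) (e - a)"
proof -
  have "(term_index b e :: ((int \<times> nat) \<times> ('n \<Rightarrow>\<^sub>0 nat)) set) = ({a} \<times> {..<\<beta>}) \<times> {m. int (mdeg m) = e - a}"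
    using assms by (auto simp: term_index_def gens_def split: if_splits)
  then show ?thesis by (simp add: card_cartesian_product monomial_count_def)
qed

text \<open>Stars and bars: an enumeration of the variables turns exponent vectors into lists of
  prescribed length and sum.\<close>

lemma monomial_count_eq_binomial:
  "monomial_count TYPE('n::finite) (int d) = (d + CARD('n) - 1) choose d"
proof -
  obtain xs :: "'n list" where xs: "set xs = UNIV" "distinct xs"
    using finite_distinct_list[of "UNIV :: 'n set"] by auto
  have len: "length xs = CARD('n)" using xs distinct_card by fastforce
  define F where "F m = map (lookup m) xs" for m :: "'n \<Rightarrow>\<^sub>0 nat"
  have "bij_betw F {m. mdeg m = d} {l. length l = CARD('n) \<and> sum_list l = d}"
  proof (rule bij_betw_imageI)
    show "inj_on F {m. mdeg m = d}"
      using xs by (auto simp: inj_on_def F_def intro!: poly_mapping_eqI)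
    have F: "sum_list (F m) = mdeg m" "length (F m) = CARD('n)" for m
      using xs by (simp_all add: F_def mdeg_def sum_list_distinct_conv_sum_set len)
    show "F ` {m. mdeg m = d} = {l. length l = CARD('n) \<and> sum_list l = d}"
    proof
      show "F ` {m. mdeg m = d} \<subseteq> {l. length l = CARD('n) \<and> sum_list l = d}"
        using F by auto
      show "{l. length l = CARD('n) \<and> sum_list l = d} \<subseteq> F ` {m. mdeg m = d}"
      proof
        fix l assume l: "l \<in> {l. length l = CARD('n) \<and> sum_list l = d}"
        define m where "m = (\<Sum>k<CARD('n). single (xs ! k) (l ! k))"
        have "lookup m (xs ! k) = l ! k" if k: "k < CARD('n)" for k
        proof -
          have "lookup m (xs ! k) = (\<Sum>k'<CARD('n). if k' = k then l ! k else 0)"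
            unfolding m_def lookup_sum using xs(2) k len
            by (intro sum.cong) (auto simp: lookup_single when_def nth_eq_iff_index_eq)
          then show ?thesis using k by simp
        qed
        then have "F m = l" using l len by (intro nth_equalityI) (auto simp: F_def)
        then show "l \<in> F ` {m. mdeg m = d}" using F(1)[of m] l by auto
      qed
    qed
  qed
  then have "card {m :: 'n \<Rightarrow>\<^sub>0 nat. mdeg m = d} = card {l :: nat list. length l = CARD('n) \<and> sum_list l = d}"
    by (rule bij_betw_same_card)
  then show ?thesis by (simp add: monomial_count_def card_length_sum_list)
qed

text \<open>Consecutive values have quotient \<open>1 + (CARD('n) - 1) / (n + 1)\<close>, which
  tends to 1; a shift by \<open>k\<close> is a product of \<open>k\<close> such quotients.\<close>

lemma monomial_count_ratio:
  "(\<lambda>n. real (monomial_count TYPE('n::finite) (int (n + k))) / real (monomial_count TYPE('n) (int n))) \<longlonglongrightarrow> 1"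
proof -
  let ?M = "\<lambda>n. monomial_count TYPE('n) (int n)"
  have pos: "?M n > 0" for n
  proof -
    have "0 < CARD('n)" by simp
    then have "n \<le> n + CARD('n) - 1" by linarith
    then show ?thesis by (simp only: monomial_count_eq_binomial zero_less_binomial_iff)
  qed
  have rec: "real (?M (Suc n)) / real (?M n) = 1 + real (CARD('n) - 1) * inverse (real (Suc n))" for n
  proof -
    have "Suc n * ?M (Suc n) = (n + CARD('n)) * ?M n"
      using Suc_times_binomial[of n "n + CARD('n) - 1"]
      by (simp only: monomial_count_eq_binomial) (simp add: Suc_diff_Suc)
    then have "real (Suc n) * real (?M (Suc n)) = real (n + CARD('n)) * real (?M n)"
      by (metis of_nat_mult)
    then have "real (?M (Suc n)) / real (?M n) = real (n + CARD('n)) / real (Suc n)"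
      using pos[of n] by (simp add: frac_eq_eq mult.commute)
    also have "real (n + CARD('n)) = real (Suc n) + real (CARD('n) - 1)"
      using zero_less_card_finite[where 'a = 'n] by simp
    finally show ?thesis by (simp add: divide_simps)
  qed
  show ?thesis
  proof (induction k)
    case 0
    then show ?case using pos by (simp add: less_imp_neq[symmetric])
  next
    case (Suc k)
    have "(\<lambda>n. 1 + real (CARD('n) - 1) * inverse (real (Suc n))) \<longlonglongrightarrow> 1 + real (CARD('n) - 1) * 0"
      by (intro tendsto_intros LIMSEQ_inverse_real_of_nat)
    then have "(\<lambda>n. real (?M (Suc n)) / real (?M n)) \<longlonglongrightarrow> 1" by (simp only: rec) simp
    from LIMSEQ_ignore_initial_segment[OF this, of k]
    have "(\<lambda>n. real (?M (Suc (n + k))) / real (?M (n + k))) \<longlonglongrightarrow> 1" .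
    from tendsto_mult[OF this Suc]
    have "(\<lambda>n. real (?M (Suc (n + k))) / real (?M (n + k)) * (real (?M (n + k)) / real (?M n))) \<longlonglongrightarrow> 1"
      by simp
    moreover have "real (?M (Suc (n + k))) / real (?M (n + k)) * (real (?M (n + k)) / real (?M n))
        = real (?M (n + Suc k)) / real (?M n)" for n
      using pos[of "n + k"] by simp
    ultimately show ?case by (simp only:)
  qed
qed

section \<open>Bounds on the Hilbert function of an ideal, and its rank\<close>

lemma ideal_part_dim_le:
  "kv.dim (emb ` I \<inter> fdeg e :: ('n::finite, 'k::field) fmod set) \<le> monomial_count TYPE('n) e"
proof -
  have fin: "finite (term_index unit_rank e :: ((int \<times> nat) \<times> ('n \<Rightarrow>\<^sub>0 nat)) set)"
    by (rule finite_term_index) (simp add: gens_unit_rank)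
  have "emb ` I \<inter> fdeg e \<subseteq> (kv.span (term_of ` term_index unit_rank e) :: ('n, 'k) fmod set)"
    by (auto intro!: fcar_fdeg_span)
  then have "kv.dim (emb ` I \<inter> fdeg e :: ('n, 'k) fmod set) \<le> card (term_of ` term_index unit_rank e :: ('n, 'k) fmod set)"
    by (rule kv.dim_le_card) (use fin in simp)
  also have "\<dots> \<le> card (term_index unit_rank e :: ((int \<times> nat) \<times> ('n \<Rightarrow>\<^sub>0 nat)) set)"
    by (rule card_image_le[OF fin])
  also have "\<dots> = monomial_count TYPE('n) e"
    using card_term_index[of unit_rank 0 1 e, where 'n = 'n] by (simp add: unit_rank_def)
  finally show ?thesis .
qed

text \<open>Multiplication by \<open>f\<close> is injective and raises degrees by \<open>D\<close>,
  so the monomials of degree \<open>e - D\<close> yield independent elements of the ideal in degree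
  \<open>e\<close>.\<close>

lemma ideal_part_dim_ge:
  fixes I :: "('n::finite, 'k::field) mpoly set"
  assumes mult: "\<And>p r. p \<in> I \<Longrightarrow> r * p \<in> I" and f: "f \<in> I" "f \<noteq> 0" "f \<in> homogeneous_part D"
  shows "monomial_count TYPE('n) (e - D) \<le> kv.dim (emb ` I \<inter> fdeg e)"
proof -
  let ?A = "{m :: 'n \<Rightarrow>\<^sub>0 nat. int (mdeg m) = e - D}"
  let ?g = "\<lambda>m. emb (single m 1 * f)"
  have finA: "finite ?A"
    by (rule finite_subset[OF _ finite_mdeg[of "nat (e - D)"]]) auto
  have comb: "(\<Sum>m\<in>?A. kscale (c m) (?g m)) = emb ((\<Sum>m\<in>?A. single m (c m)) * f)" for c
  proof -
    have "kscale (c m) (?g m) = emb (single m (c m) * f)" for m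
      by (simp add: mult_single flip: mult.assoc)
    moreover have "(\<Sum>m\<in>?A. emb (h m)) = emb (\<Sum>m\<in>?A. h m)" for h :: "_ \<Rightarrow> ('n, 'k) mpoly"
      by (rule poly_mapping_eqI) (simp add: lookup_sum lookup_single when_def)
    ultimately show ?thesis by (simp add: sum_distrib_right)
  qed
  have zero: "c m = 0" if "(\<Sum>m\<in>?A. kscale (c m) (?g m)) = 0" "m \<in> ?A" for c m
  proof -
    have "lookup (emb ((\<Sum>m\<in>?A. single m (c m)) * f)) (0, 0) = 0"
      unfolding comb[symmetric] that(1) by simp
    then have "(\<Sum>m\<in>?A. single m (c m)) * f = 0"
      unfolding lookup_single_eq .
    then have "(\<Sum>m\<in>?A. single m (c m)) = 0" using mpoly_mult_nonzero f(2) by blast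
    then have "lookup (\<Sum>m\<in>?A. single m (c m)) m = 0" by simp
    then show ?thesis using finA that(2) by (simp add: lookup_sum lookup_single when_def)
  qed
  have inj: "inj_on ?g ?A"
  proof (rule inj_onI, rule ccontr)
    fix x y assume xy: "x \<in> ?A" "y \<in> ?A" "?g x = ?g y" "x \<noteq> y"
    from arg_cong[OF xy(3), of "\<lambda>v. lookup v (0, 0)"]
    have "single x 1 * f = single y 1 * f" unfolding lookup_single_eq .
    then have "(single x 1 - single y 1) * f = 0" by (simp add: left_diff_distrib)
    then have "single x (1 :: 'k) - single y 1 = 0" using mpoly_mult_nonzero f(2) by blast
    then have "lookup (single x (1 :: 'k) - single y 1) x = 0" by simp
    then show False using xy(4) by (simp add: lookup_minus lookup_single)
  qed
  have ind: "kv.independent (?g ` ?A)"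
  proof (rule kv.independent_if_scalars_zero)
    fix c v assume "(\<Sum>v\<in>?g ` ?A. kscale (c v) v) = 0" "v \<in> ?g ` ?A"
    then show "c v = 0" using zero[of "\<lambda>m. c (?g m)"] by (auto simp: sum.reindex[OF inj])
  qed (use finA in simp)
  have sub: "?g ` ?A \<subseteq> emb ` I \<inter> fdeg e"
  proof
    fix v assume "v \<in> ?g ` ?A"
    then obtain m where m: "int (mdeg m) = e - D" "v = ?g m" by blast
    have "single m 1 * f \<in> homogeneous_part ((e - D) + D)"
      using m f(3) by (intro homogeneous_part_mult) (simp_all add: homogeneous_part_single)
    then show "v \<in> emb ` I \<inter> fdeg e" using m mult[OF f(1)] by (simp add: emb_fdeg_iff)
  qed
  obtain B where B: "B \<subseteq> emb ` I \<inter> fdeg e" "kv.independent B" "emb ` I \<inter> fdeg e \<subseteq> kv.span B"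
      "card B = kv.dim (emb ` I \<inter> fdeg e)"
    by (rule kv.basis_exists)
  have "B \<subseteq> kv.span (term_of ` term_index unit_rank e)"
    by (rule subset_trans[OF B(1)]) (auto intro!: fcar_fdeg_span)
  moreover have "finite (term_of ` term_index unit_rank e :: ('n, 'k) fmod set)"
    by (intro finite_imageI finite_term_index) (simp add: gens_unit_rank)
  ultimately have "finite B" using kv.independent_span_bound[OF _ B(2)] by blast
  then have "card (?g ` ?A) \<le> card B"
    using kv.independent_span_bound[OF _ ind] sub B(3) by blast
  then show ?thesis by (simp add: card_image[OF inj] B(4) monomial_count_def)
qed

text \<open>
  The Hilbert function of \<open>I\<close> is squeezed between shifts of that of \<open>R\<close>, and these are asymptotically
  equal, so comparing growth rates computes the rank of \<open>I\<close>.
\<close>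

lemma linear_resolution_alternating_sum:
  fixes I :: "('n::finite, 'k::field) mpoly set"
  assumes res: "augmented_resolution B \<Phi> (emb ` I)" and "B 0 = unit_rank"
    and lin: "\<And>i j. B (Suc i) j = (if j = d + int i then \<beta> i else 0)" and "d \<ge> 0"
    and \<beta>: "\<And>i. i > t \<Longrightarrow> \<beta> i = 0"
    and mult: "\<And>p r. p \<in> I \<Longrightarrow> r * p \<in> I" and part: "\<And>p e. p \<in> I \<Longrightarrow> hpart e p \<in> I"
    and nz: "p \<in> I" "p \<noteq> 0"
  shows "(\<Sum>i\<le>t. (-1) ^ i * real (\<beta> i)) = 1"
proof -
  let ?M = "\<lambda>e. monomial_count TYPE('n) e"
  \<comment> \<open>Any monomial of \<open>p\<close> singles out a nonzero homogeneous component,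
    which stays in \<open>I\<close> by \<open>part\<close>.\<close>
  obtain m where m: "lookup p m \<noteq> 0" using nz(2) by (metis lookup_zero poly_mapping_eqI)
  define D where "D = mdeg m"
  define f where "f = hpart (int D) p"
  have "lookup f m \<noteq> 0" using m by (simp add: f_def D_def)
  then have "f \<noteq> 0" by auto
  then have f: "f \<in> I" "f \<noteq> 0" "f \<in> homogeneous_part (int D)"
    using part[OF nz(1)] by (simp_all add: f_def hpart_in)
  have gens: "gens (B (Suc i)) = {d + int i} \<times> {..<\<beta> i}" for i
    by (auto simp: gens_def lin split: if_splits)
  have "finite (gens (B i))" for i
    by (cases i) (simp_all add: \<open>B 0 = unit_rank\<close> gens_unit_rank gens)
  then have "int (kv.dim (emb ` I \<inter> fdeg e)) = (\<Sum>i\<le>t. (-1) ^ i *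
      int (card (term_index (B (Suc i)) e :: ((int \<times> nat) \<times> ('n \<Rightarrow>\<^sub>0 nat)) set)))" for e
    by (intro augmented_resolution_hilbert[OF res]) (simp_all add: gens \<beta>)
  then have hilb: "int (kv.dim (emb ` I \<inter> fdeg e)) = (\<Sum>i\<le>t. (-1) ^ i * int (\<beta> i * ?M (e - (d + int i))))" for e
    by (simp only: card_term_index[OF lin])
  \<comment> \<open>\<open>s\<close> is at least every shift \<open>d + i\<close> with
    \<open>i \<le> t\<close> and at least \<open>D\<close>, so each Hilbert function is evaluated at
    \<open>n\<close> plus a natural number.\<close>
  define s where "s = nat d + t + D"
  have shift: "int (n + s) - (d + int i) = int (n + (s - (nat d + i)))" if "i \<le> t" for i n
    using \<open>d \<ge> 0\<close> that by (simp add: s_def)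
  have dim: "real (kv.dim (emb ` I \<inter> fdeg (int (n + s))))
      = (\<Sum>i\<le>t. (-1) ^ i * real (\<beta> i) * real (?M (int (n + (s - (nat d + i))))))" for n
  proof -
    have "real (kv.dim (emb ` I \<inter> fdeg (int (n + s)))) = real_of_int (int (kv.dim (emb ` I \<inter> fdeg (int (n + s)))))"
      by simp
    also have "\<dots> = (\<Sum>i\<le>t. (-1) ^ i * real (\<beta> i) * real (?M (int (n + s) - (d + int i))))"
      unfolding hilb by (simp add: mult.assoc)
    also have "\<dots> = (\<Sum>i\<le>t. (-1) ^ i * real (\<beta> i) * real (?M (int (n + (s - (nat d + i))))))"
      by (intro sum.cong refl) (simp only: shift atMost_iff)
    finally show ?thesis .
  qed
  define q where "q k n = real (?M (int (n + k))) / real (?M (int n))" for k n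
  have q: "q k \<longlonglongrightarrow> 1" for k
    unfolding q_def by (rule monomial_count_ratio)
  have ratio: "real (kv.dim (emb ` I \<inter> fdeg (int (n + s)))) / real (?M (int n))
      = (\<Sum>i\<le>t. (-1) ^ i * real (\<beta> i) * q (s - (nat d + i)) n)" for n
    by (simp only: dim q_def sum_divide_distrib times_divide_eq_right)
  have "(\<lambda>n. \<Sum>i\<le>t. (-1) ^ i * real (\<beta> i) * q (s - (nat d + i)) n) \<longlonglongrightarrow> (\<Sum>i\<le>t. (-1) ^ i * real (\<beta> i) * 1)"
    by (intro tendsto_sum tendsto_mult tendsto_const q)
  moreover have "(\<lambda>n. \<Sum>i\<le>t. (-1) ^ i * real (\<beta> i) * q (s - (nat d + i)) n) \<longlonglongrightarrow> 1"
  proof (rule tendsto_sandwich[OF _ _ q[of "s - D"] q[of s]])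
    show "\<forall>\<^sub>F n in sequentially. q (s - D) n \<le> (\<Sum>i\<le>t. (-1) ^ i * real (\<beta> i) * q (s - (nat d + i)) n)"
    proof (intro always_eventually allI)
      fix n
      have "?M (int (n + s) - int D) \<le> kv.dim (emb ` I \<inter> fdeg (int (n + s)))"
        by (rule ideal_part_dim_ge[OF mult f])
      moreover have "int (n + s) - int D = int (n + (s - D))" by (simp add: s_def)
      ultimately show "q (s - D) n \<le> (\<Sum>i\<le>t. (-1) ^ i * real (\<beta> i) * q (s - (nat d + i)) n)"
        unfolding ratio[symmetric] unfolding q_def by (intro divide_right_mono) simp_all
    qed
    show "\<forall>\<^sub>F n in sequentially. (\<Sum>i\<le>t. (-1) ^ i * real (\<beta> i) * q (s - (nat d + i)) n) \<le> q s n"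
      unfolding ratio[symmetric] unfolding q_def
      by (intro always_eventually allI divide_right_mono of_nat_mono ideal_part_dim_le) simp_all
  qed
  ultimately show ?thesis using LIMSEQ_unique by fastforce
qed

section \<open>Homogeneous ideals and their Betti numbers\<close>

lemma hpart_sum_decomposition: "\<exists>E. finite E \<and> p = (\<Sum>e\<in>E. hpart e p)"
proof -
  obtain E where E: "finite E" "emb p = (\<Sum>e\<in>E. fpart e (emb p))"
    using fpart_sum_decomposition by blast
  from arg_cong[OF E(2), of "\<lambda>v. lookup v (0, 0)"] have "p = (\<Sum>e\<in>E. hpart e p)"
    by (simp add: lookup_sum)
  with E(1) show ?thesis by blast
qed

lemma hpart_homogeneous: "p \<in> homogeneous_part k \<Longrightarrow> hpart e p = (if e = k then p else 0)"
  by (auto simp: hpart_id homogeneous_part_iff when_def intro!: poly_mapping_eqI)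

lemma homogeneous_ideal_imp_ideal:
  assumes "homogeneous_ideal I"
  shows "ideal I mpoly_ring"
proof -
  interpret R: ring "mpoly_ring :: ('a, 'b) mpoly ring" by (rule ring_from_type_algebra)
  show ?thesis
    using assms R.genideal_ideal by (auto simp: homogeneous_ideal_def)
qed

text \<open>\<open>homogeneous_ideal\<close> only provides homogeneous generators. The elements all
  of whose components lie in \<open>I\<close> form an ideal that contains these generators, hence
  contains \<open>I\<close>.\<close>

lemma homogeneous_ideal_hpart:
  fixes I :: "('n::finite, 'k::field) mpoly set"
  assumes I: "homogeneous_ideal I" and p: "p \<in> I"
  shows "hpart e p \<in> I"
proof -
  interpret R: ring "mpoly_ring :: ('n, 'k) mpoly ring" by (rule ring_from_type_algebra)
  note closed = ideal_module_subspace[OF homogeneous_ideal_imp_ideal[OF I]]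
  obtain S where S: "S \<subseteq> (\<Union>e. homogeneous_part e)" "I = genideal mpoly_ring S"
    using I by (auto simp: homogeneous_ideal_def)
  define J where "J = {p. \<forall>e. hpart e p \<in> I}"
  have J_mult: "r * q \<in> J" if "q \<in> J" for q r
    unfolding J_def mem_Collect_eq
  proof
    fix e
    obtain E where E: "finite E" "q = (\<Sum>k\<in>E. hpart k q)"
      using hpart_sum_decomposition by blast
    have "hpart e (r * q) = (\<Sum>k\<in>E. hpart e (r * hpart k q))"
      by (subst E(2)) (simp add: sum_distrib_left hpart_sum)
    also have "\<dots> = (\<Sum>k\<in>E. hpart (e - k) r * hpart k q)"
      by (simp add: hpart_mult[OF hpart_in])
    also have "\<dots> \<in> I"
      using E(1) that
      by (induction E rule: finite_induct) (auto simp: J_def intro: closed)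
    finally show "hpart e (r * q) \<in> I" .
  qed
  have "ideal J mpoly_ring"
  proof (rule idealI)
    show "ring (mpoly_ring :: ('n, 'k) mpoly ring)" by (rule R.ring_axioms)
    show "subgroup J (add_monoid (mpoly_ring :: ('n, 'k) mpoly ring))"
    proof (rule group.subgroupI[OF R.a_group])
      show "J \<noteq> {}" using closed(1) by (auto simp: J_def intro!: exI[of _ 0])
      fix a assume a: "a \<in> J"
      have "\<ominus>\<^bsub>mpoly_ring\<^esub> a = - 1 * a"
        by (rule R.minus_equality) simp_all
      then show "inv\<^bsub>add_monoid (mpoly_ring :: ('n, 'k) mpoly ring)\<^esub> a \<in> J"
        using J_mult[OF a, of "- 1"] by (simp add: a_inv_def)
      fix b assume "b \<in> J"
      with a show "a \<otimes>\<^bsub>add_monoid (mpoly_ring :: ('n, 'k) mpoly ring)\<^esub> b \<in> J"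
        by (simp add: J_def hpart_add closed)
    qed simp
    fix a x assume "a \<in> J"
    then show "x \<otimes>\<^bsub>mpoly_ring\<^esub> a \<in> J" "a \<otimes>\<^bsub>mpoly_ring\<^esub> x \<in> J"
      using J_mult[of a x] by (simp_all add: mult.commute)
  qed
  moreover have "S \<subseteq> J"
  proof
    fix s assume s: "s \<in> S"
    then obtain k where "s \<in> homogeneous_part k" using S(1) by blast
    moreover have "s \<in> I" using R.genideal_self[of S] s S(2) by auto
    ultimately show "s \<in> J" by (simp add: J_def hpart_homogeneous closed)
  qed
  ultimately have "I \<subseteq> J" unfolding S(2) by (rule R.genideal_minimal)
  with p show ?thesis by (auto simp: J_def)
qed

lemma homogeneous_ideal_graded_submodule:
  assumes "homogeneous_ideal I"
  shows "graded_submodule unit_rank (emb ` I)"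
proof -
  note closed = ideal_module_subspace[OF homogeneous_ideal_imp_ideal[OF assms]]
  have "pm.subspace (emb ` I)"
    unfolding pm.subspace_def
  proof (intro conjI ballI allI)
    show "0 \<in> emb ` I" using closed(1) by (metis image_eqI single_zero)
    fix v assume v: "v \<in> emb ` I"
    show "pscale r v \<in> emb ` I" for r using v closed(3) by auto
    fix w assume w: "w \<in> emb ` I"
    then show "v + w \<in> emb ` I" using v closed(2) by (auto simp: single_add[symmetric])
  qed
  moreover have "fpart e (emb p) = emb (hpart e p)" for e and p :: "('a, 'b) mpoly"
    by (rule poly_mapping_eqI) (auto simp: lookup_single when_def)
  ultimately show ?thesis
    using homogeneous_ideal_hpart[OF assms] by (auto simp: graded_submodule_def)
qed

lemma betti_ideal:
  assumes "augmented_resolution B \<Phi> (emb ` I)" "B 0 = unit_rank"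
  shows "betti (ideal_gmodule I) = (\<lambda>i. B (Suc i))"
  unfolding betti_def ideal_resolution_iff
proof (rule the_equality)
  have "case_nat unit_rank (\<lambda>i. B (Suc i)) = B"
    using assms(2) by (auto split: nat.split)
  then show "\<exists>\<Phi>. augmented_resolution (case_nat unit_rank (\<lambda>i. B (Suc i))) \<Phi> (emb ` I)"
    using assms(1) by auto
  fix b assume "\<exists>\<Phi>. augmented_resolution (case_nat unit_rank b) \<Phi> (emb ` I)"
  then obtain \<Phi>' where "augmented_resolution (case_nat unit_rank b) \<Phi>' (emb ` I)" ..
  then have "case_nat unit_rank b = B"
    by (rule augmented_resolution_unique[OF _ assms(1)]) (simp add: assms(2))
  then show "b = (\<lambda>i. B (Suc i))" by (metis nat.case(2))
qed

lemma betti_quotient: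
  assumes "augmented_resolution B \<Phi> (emb ` I)" "B 0 = unit_rank"
    and "ideal I mpoly_ring" "\<forall>p\<in>I. lookup p 0 = 0"
  shows "betti (quotient_gmodule I) = B"
  unfolding betti_def quotient_resolution_iff[OF assms(3,4)]
proof (rule the_equality)
  show "B 0 = unit_rank \<and> (\<exists>\<Phi>. augmented_resolution B \<Phi> (emb ` I))"
    using assms by blast
  fix b assume "b 0 = unit_rank \<and> (\<exists>\<Phi>. augmented_resolution b \<Phi> (emb ` I))"
  then show "b = B"
    using augmented_resolution_unique[OF _ assms(1)] assms(2) by metis
qed

text \<open>All generators of the module above \<open>R\<close> have degree \<open>d\<close>, which
  is not 0, so their images in \<open>R\<close> are forms without constant term; the same follows
  for all combinations of these images.\<close>

lemma linear_imp_in_maximal_ideal: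
  assumes res: "augmented_resolution B \<Phi> (emb ` I)" "B 0 = unit_rank"
    and B: "\<And>j. j \<noteq> d \<Longrightarrow> B (Suc 0) j = 0" and "d \<noteq> 0" "p \<in> I"
  shows "lookup p 0 = 0"
proof -
  have "graded_matrix (B 0) (\<Phi> 0)" and im: "lin (\<Phi> 0) ` fcar (B 1) = emb ` I"
    using res(1) unfolding augmented_resolution_def by blast+
  then have gr: "graded_matrix unit_rank (\<Phi> 0)" by (simp add: res(2))
  have "emb p \<in> lin (\<Phi> 0) ` fcar (B 1)" unfolding im using \<open>p \<in> I\<close> by blast
  then obtain v where v: "v \<in> fcar (B 1)" "emb p = lin (\<Phi> 0) v" by blast
  have "lookup (lookup (\<Phi> 0 g) (0, 0)) 0 = 0" if "g \<in> keys v" for g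
  proof -
    have "g \<in> gens (B 1)" using v(1) that by (auto simp: fcar_def)
    then have "fst g = d" using B[of "fst g"] by (cases "fst g = d") (auto simp: gens_def)
    moreover have "\<Phi> 0 g \<in> fdeg (fst g)" using gr by (simp add: graded_matrix_def)
    ultimately show ?thesis using fdeg_lookup_0[of "\<Phi> 0 g" d "(0, 0)"] \<open>d \<noteq> 0\<close> by auto
  qed
  moreover from arg_cong[OF v(2), of "\<lambda>v. lookup v (0, 0)"]
  have "p = (\<Sum>g\<in>keys v. lookup v g * lookup (\<Phi> 0 g) (0, 0))"
    by (simp add: lookup_lin)
  ultimately show ?thesis by (simp add: lookup_sum lookup_mult_0)
qed

section \<open>Pure diagrams\<close>

text \<open>The \<open>i\<close> factors with \<open>k < i\<close> are negative and give
  \<open>(-1)^i / i!\<close>; those with \<open>k > i\<close> give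
  \<open>1 / (l - i)!\<close>.\<close>

lemma prod_inverse_differences:
  assumes "i \<le> l"
  shows "(\<Prod>k\<in>{..l} - {i}. 1 / (of_int (int k - int i) :: rat)) = (-1) ^ i / (fact i * fact (l - i))"
  using assms
proof (induction l rule: dec_induct)
  case base
  have "{..i} - {i} = {..<i}" by auto
  \<comment> \<open>The product is reversed, so that the differences run through
    \<open>-1, \<dots>, -i\<close> in this order.\<close>
  then have "(\<Prod>k\<in>{..i} - {i}. 1 / (of_int (int k - int i) :: rat)) = (\<Prod>k<i. 1 / of_int (int (i - Suc k) - int i))"
    by (simp only: prod.nat_diff_reindex[where g = "\<lambda>k. 1 / (of_int (int k - int i) :: rat)"])
  also have "\<dots> = (\<Prod>k<i. - 1 * (1 / of_nat (Suc k)))"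
    by (intro prod.cong) (auto simp: of_nat_diff field_simps)
  also have "\<dots> = (-1) ^ i * (1 / (\<Prod>k<i. of_nat (Suc k)))"
    by (simp only: prod.distrib prod_constant card_lessThan prod_dividef prod.neutral_const power_one)
  also have "(\<Prod>k<i. of_nat (Suc k)) = (fact i :: rat)"
    by (simp only: fact_prod_Suc of_nat_prod atLeast0LessThan)
  finally show ?case by simp
next
  case (step l)
  have "{..Suc l} - {i} = insert (Suc l) ({..l} - {i})" using step(1) by auto
  then have "(\<Prod>k\<in>{..Suc l} - {i}. 1 / (of_int (int k - int i) :: rat))
      = 1 / of_int (int (Suc l) - int i) * ((-1) ^ i / (fact i * fact (l - i)))"
    using step.IH by simp
  also have "int (Suc l) - int i = int (Suc (l - i))" using step(1) by simp
  also have "fact (Suc l - i) = (of_nat (Suc (l - i)) * fact (l - i) :: rat)"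
    using step(1) by (simp add: Suc_diff_le)
  ultimately show ?case by (simp add: field_simps)
qed

text \<open>The sign in \<open>pure_diagram\<close> cancels the one from the \<open>i\<close>
  negative differences, and \<open>l!\<close> completes the remaining factorials to a binomial
  coefficient.\<close>

lemma fact_pure_diagram_consecutive:
  "fact l * pure_diagram [d..d + int l] i j = (if j = d + int i then of_nat (l choose i) else 0)"
proof (cases "i \<le> l \<and> j = d + int i")
  case True
  then have "pure_diagram [d..d + int l] i j
      = (-1) ^ i * (\<Prod>k\<in>{..<Suc l} - {i}. 1 / of_int ([d..d + int l] ! k - [d..d + int l] ! i))"
    by (simp add: pure_diagram_def nth_upto nat_add_distrib)
  also have "(\<Prod>k\<in>{..<Suc l} - {i}. 1 / of_int ([d..d + int l] ! k - [d..d + int l] ! i))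
      = (\<Prod>k\<in>{..l} - {i}. 1 / (of_int (int k - int i) :: rat))"
    using True by (intro prod.cong) (auto simp: nth_upto)
  also have "\<dots> = (-1) ^ i / (fact i * fact (l - i))"
    using True by (intro prod_inverse_differences) simp
  finally show ?thesis using True by (simp add: binomial_fact flip: power_add)
next
  case False
  then show ?thesis by (auto simp: pure_diagram_def nth_upto binomial_eq_0)
qed

lemma lessThan_Suc_Suc: "{..<Suc (Suc l)} = insert 0 (Suc ` {..l})"
  by (subst lessThan_Suc_eq_insert_0) (simp only: lessThan_Suc_atMost)

text \<open>Prepending 0 moves position \<open>i\<close> to \<open>i + 1\<close> and adds the factor
  \<open>1 / (0 - (d + i))\<close>, whose sign cancels the extra sign of the shifted
  position.\<close>

lemma fact_pure_diagram_cone: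
  assumes "d \<ge> 1"
  shows "fact l * pure_diagram (0 # [d..d + int l]) (Suc i) j
    = (if j = d + int i then of_nat (l choose i) / of_int (d + int i) else 0)"
proof (cases "i \<le> l \<and> j = d + int i")
  case True
  let ?ds = "0 # [d..d + int l]"
  define c :: rat where "c = of_int (d + int i)"
  have "pure_diagram ?ds (Suc i) j
      = (-1) ^ Suc i * (\<Prod>k\<in>{..<Suc (Suc l)} - {Suc i}. 1 / of_int (?ds ! k - ?ds ! Suc i))"
    using True by (simp add: pure_diagram_def nth_upto nat_add_distrib)
  also have "{..<Suc (Suc l)} - {Suc i} = insert 0 (Suc ` ({..l} - {i}))"
    unfolding lessThan_Suc_Suc by auto
  also have "(\<Prod>k\<in>insert 0 (Suc ` ({..l} - {i})). 1 / (of_int (?ds ! k - ?ds ! Suc i) :: rat))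
      = 1 / of_int (- (d + int i)) * (\<Prod>k\<in>{..l} - {i}. 1 / (of_int (?ds ! Suc k - ?ds ! Suc i) :: rat))"
    using True by (simp add: prod.reindex nth_upto)
  also have "(\<Prod>k\<in>{..l} - {i}. 1 / (of_int (?ds ! Suc k - ?ds ! Suc i) :: rat))
      = (\<Prod>k\<in>{..l} - {i}. 1 / (of_int (int k - int i) :: rat))"
    using True by (intro prod.cong) (auto simp: nth_upto)
  also have "\<dots> = (-1) ^ i / (fact i * fact (l - i))"
    using True by (intro prod_inverse_differences) simp
  finally have "pure_diagram ?ds (Suc i) j
      = ((-1) ^ i * (-1) ^ i) / (c * (fact i * fact (l - i)))"
    unfolding of_int_minus c_def[symmetric] by simp
  also have "(-1) ^ i * (-1) ^ i = (1 :: rat)" by (simp flip: power_add)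
  finally show ?thesis using True by (simp add: binomial_fact c_def)
next
  case False
  then show ?thesis by (auto simp: pure_diagram_def nth_upto binomial_eq_0)
qed

lemma pure_diagram_cone_0:
  assumes "d \<ge> 1"
  shows "pure_diagram (0 # [d..d + int l]) 0 j = (if j = 0 then \<Prod>k\<le>l. 1 / of_int (d + int k) else 0)"
proof -
  have "{..<Suc (Suc l)} - {0} = Suc ` {..l}"
    unfolding lessThan_Suc_Suc by auto
  then show ?thesis
    by (simp add: pure_diagram_def prod.reindex nth_upto nat_add_distrib)
qed

text \<open>With \<open>T l = \<alpha> l * l! / (d (d + 1) \<dots> (d + l - 1))\<close> the summand
  is \<open>T l - T (l + 1)\<close>, so the sum telescopes to
  \<open>T 0 - T (n + 1)\<close>.\<close>

lemma cone_coefficient_sum_0: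
  fixes \<alpha> :: "nat \<Rightarrow> rat"
  assumes "d \<ge> 1"
  shows "(\<Sum>l\<le>n. (of_int (d + int l) * \<alpha> l - of_nat (l + 1) * \<alpha> (l + 1)) * fact l *
      (\<Prod>k\<le>l. 1 / of_int (d + int k))) = \<alpha> 0 - \<alpha> (Suc n) * fact (Suc n) * (\<Prod>k\<le>n. 1 / of_int (d + int k))"
proof (induction n)
  case 0
  then show ?case using assms by (simp add: field_simps)
next
  case (Suc n)
  define P :: rat where "P = (\<Prod>k\<le>n. 1 / of_int (d + int k))"
  define c :: rat where "c = of_int (d + int (Suc n))"
  have "c \<noteq> 0" using assms by (simp add: c_def)
  have "(\<Sum>l\<le>Suc n. (of_int (d + int l) * \<alpha> l - of_nat (l + 1) * \<alpha> (l + 1)) * fact l *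
      (\<Prod>k\<le>l. 1 / of_int (d + int k)))
    = \<alpha> 0 - \<alpha> (Suc n) * fact (Suc n) * P
      + (c * \<alpha> (Suc n) - of_nat (Suc (Suc n)) * \<alpha> (Suc (Suc n))) * fact (Suc n) * (P * (1 / c))"
    unfolding sum.atMost_Suc Suc prod.atMost_Suc P_def c_def by simp
  also have "\<dots> = \<alpha> 0 - \<alpha> (Suc (Suc n)) * (of_nat (Suc (Suc n)) * fact (Suc n)) * (P * (1 / c))"
    using \<open>c \<noteq> 0\<close> by (simp add: field_simps)
  finally show ?case by (simp only: fact_Suc[of "Suc n"] prod.atMost_Suc P_def c_def)
qed

text \<open>Collecting the terms of each \<open>\<alpha> l\<close> reduces this to \<open>(d + l)
  binom(l, i) - l binom(l - 1, i) = (d + i) binom(l, i)\<close>, that is, to the absorption rule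
  \<open>l binom(l - 1, i) = (l - i) binom(l, i)\<close>. Only the boundary term with
  \<open>\<alpha> (Suc n)\<close> is left over.\<close>

lemma cone_coefficient_sum_Suc:
  fixes \<alpha> :: "nat \<Rightarrow> rat"
  shows "(\<Sum>l\<le>n. (of_int (d + int l) * \<alpha> l - of_nat (l + 1) * \<alpha> (l + 1)) * of_nat (l choose i))
    = of_int (d + int i) * (\<Sum>l\<le>n. \<alpha> l * of_nat (l choose i)) - \<alpha> (Suc n) * of_nat (Suc n) * of_nat (n choose i)"
proof (induction n)
  case 0
  then show ?case by (cases i) (simp_all add: algebra_simps)
next
  case (Suc n)
  \<comment> \<open>The difference is taken among rationals and may be negative; in that case the
    binomial coefficients on both sides are 0.\<close>
  have absorb: "(of_nat (Suc n) - of_nat i) * of_nat (Suc n choose i) = (of_nat (Suc n) * of_nat (n choose i) :: rat)"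
  proof (cases "i \<le> Suc n")
    case True
    then have "(of_nat (Suc n) - of_nat i :: rat) = of_nat (Suc n - i)" by (simp only: of_nat_diff)
    then show ?thesis
      using binomial_absorb_comp[of "Suc n" i] by (metis diff_Suc_1 of_nat_mult)
  qed (simp add: binomial_eq_0)
  from arg_cong[OF absorb, of "(*) (\<alpha> (Suc n))"]
  have "(of_int (d + int (Suc n)) * \<alpha> (Suc n)) * of_nat (Suc n choose i) - \<alpha> (Suc n) * of_nat (Suc n) * of_nat (n choose i)
      = (of_int (d + int i) * \<alpha> (Suc n)) * of_nat (Suc n choose i :: nat)"
    by (simp add: algebra_simps)
  then show ?case
    unfolding sum.atMost_Suc Suc by (simp add: algebra_simps)
qed

text \<open>Only the row \<open>l = 0\<close> of Pascal's triangle has a nonzero alternating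
  sum.\<close>

lemma alternating_binomial_sum:
  fixes \<alpha> :: "nat \<Rightarrow> rat"
  shows "(\<Sum>i\<le>t. (-1) ^ i * (\<Sum>l\<le>t. \<alpha> l * of_nat (l choose i))) = \<alpha> 0"
proof -
  have inner: "(\<Sum>i\<le>t. (-1) ^ i * (of_nat (l choose i) :: rat)) = (if l = 0 then 1 else 0)" if "l \<le> t" for l
  proof -
    have "(\<Sum>i\<le>t. (-1) ^ i * (of_nat (l choose i) :: rat)) = (\<Sum>i\<le>l. (-1) ^ i * of_nat (l choose i))"
      using that by (intro sum.mono_neutral_right) (auto simp: binomial_eq_0)
    then show ?thesis using choose_alternating_sum[of l, where 'a = rat] by simp
  qed
  have "(\<Sum>i\<le>t. (-1) ^ i * (\<Sum>l\<le>t. \<alpha> l * of_nat (l choose i)))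
      = (\<Sum>l\<le>t. \<alpha> l * (\<Sum>i\<le>t. (-1) ^ i * of_nat (l choose i)))"
    unfolding sum_distrib_left by (subst sum.swap) (simp add: mult_ac)
  also have "\<dots> = (\<Sum>l\<le>t. if l = 0 then \<alpha> 0 else 0)"
    by (intro sum.cong) (auto simp: inner)
  finally show ?thesis by simp
qed

section \<open>The Betti table of the quotient\<close>

theorem theorem3p6:
  fixes I :: "('n::finite, 'k::field) mpoly set"
    and d :: int and t :: nat and \<alpha> :: "nat \<Rightarrow> rat"
  assumes "d \<ge> 1"
    and "homogeneous_ideal I" and "I \<noteq> {0}"
    and "has_linear_resolution (ideal_gmodule I) d"
    and "t \<le> CARD('n)"
    and "\<forall>i j. of_nat (betti (ideal_gmodule I) i j) =
           (\<Sum>l=0..t. \<alpha> l * fact l * pure_diagram [d..d + int l] i j)"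
    and "\<alpha> (Suc t) = 0"
  shows "\<forall>i j. of_nat (betti (quotient_gmodule I) i j) =
           (\<Sum>l=0..t. (of_int (d + int l) * \<alpha> l - of_nat (l + 1) * \<alpha> (l + 1)) * fact l *
              pure_diagram (0 # [d..d + int l]) i j)"
proof (intro allI)
  fix i j
  note I = homogeneous_ideal_imp_ideal[OF assms(2)]
  \<comment> \<open>A single table \<open>B\<close> carries both modules: it will be the Betti table
    of \<open>R/I\<close>, and shifted by one place that of \<open>I\<close>.\<close>
  obtain B and \<Phi> :: "nat \<Rightarrow> int \<times> nat \<Rightarrow> ('n, 'k) fmod"
    where B0: "B 0 = unit_rank" and res: "augmented_resolution B \<Phi> (emb ` I)"
    using augmented_resolution_exists[OF _ homogeneous_ideal_graded_submodule[OF assms(2)]]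
    by (auto simp: unit_rank_def)
  define \<beta> where "\<beta> i = B (Suc i) (d + int i)" for i
  have betti: "of_nat (B (Suc i) j) = (if j = d + int i then \<Sum>l\<le>t. \<alpha> l * of_nat (l choose i) else 0)" for i j
    using assms(6) by (simp add: betti_ideal[OF res B0] mult.assoc fact_pure_diagram_consecutive atLeast0AtMost)
  have B: "B (Suc i) j = (if j = d + int i then \<beta> i else 0)" for i j
    using betti[of i j] by (cases "j = d + int i") (simp_all add: \<beta>_def)
  have \<beta>: "of_nat (\<beta> i) = (\<Sum>l\<le>t. \<alpha> l * of_nat (l choose i))" for i
    using betti[of i "d + int i"] by (simp add: \<beta>_def)
  have "lookup p 0 = 0" if "p \<in> I" for p
    using that assms(1) by (intro linear_imp_in_maximal_ideal[OF res B0, of d]) (simp_all add: B)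
  then have quot: "betti (quotient_gmodule I) = B"
    by (intro betti_quotient[OF res B0 I]) blast
  have \<alpha>0: "\<alpha> 0 = 1"
  proof -
    obtain p where p: "p \<in> I" "p \<noteq> 0"
      using assms(3) ideal_module_subspace(1)[OF I] by blast
    \<comment> \<open>For \<open>i > t \<ge> l\<close> all the coefficients
      \<open>l choose i\<close> vanish, which bounds the length of the resolution.\<close>
    have "\<beta> i = 0" if "i > t" for i
    proof -
      have "(of_nat (\<beta> i) :: rat) = 0" unfolding \<beta> using that by (simp add: binomial_eq_0)
      then show ?thesis by simp
    qed
    then have "(\<Sum>i\<le>t. (-1) ^ i * real (\<beta> i)) = 1"
      using assms(1) homogeneous_ideal_hpart[OF assms(2)] ideal_module_subspace(3)[OF I] p
      by (intro linear_resolution_alternating_sum[OF res B0 B]) simp_all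
    \<comment> \<open>The rank was computed as a limit of reals, while the coefficients are
      rational; the integers mediate between the two.\<close>
    then have "real_of_int (\<Sum>i\<le>t. (-1) ^ i * int (\<beta> i)) = real_of_int 1" by simp
    then have "(\<Sum>i\<le>t. (-1) ^ i * int (\<beta> i)) = 1" by (simp only: of_int_eq_iff)
    then have "(of_int (\<Sum>i\<le>t. (-1) ^ i * int (\<beta> i)) :: rat) = 1" by simp
    then have "(\<Sum>i\<le>t. (-1) ^ i * (of_nat (\<beta> i) :: rat)) = 1" by simp
    then show ?thesis by (simp only: \<beta> alternating_binomial_sum)
  qed
  show "of_nat (betti (quotient_gmodule I) i j) =
      (\<Sum>l=0..t. (of_int (d + int l) * \<alpha> l - of_nat (l + 1) * \<alpha> (l + 1)) * fact l *
        pure_diagram (0 # [d..d + int l]) i j)"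
  proof (cases i)
    \<comment> \<open>The boundary term of the telescoped sum contains
      \<open>\<alpha> (Suc t)\<close>, so only \<open>\<alpha> 0 = 1\<close> remains, the rank of
      \<open>R\<close> in degree 0.\<close>
    case 0
    then show ?thesis
      using cone_coefficient_sum_0[OF assms(1), of \<alpha> t] assms(7) \<alpha>0
      by (cases "j = 0") (simp_all add: quot B0 unit_rank_def pure_diagram_cone_0[OF assms(1)] atLeast0AtMost)
  next
    case (Suc i')
    have "(\<Sum>l=0..t. (of_int (d + int l) * \<alpha> l - of_nat (l + 1) * \<alpha> (l + 1)) * fact l *
        pure_diagram (0 # [d..d + int l]) i j)
      = (if j = d + int i' then (\<Sum>l\<le>t. (of_int (d + int l) * \<alpha> l - of_nat (l + 1) * \<alpha> (l + 1)) *
          of_nat (l choose i')) / of_int (d + int i') else 0)"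
      unfolding Suc mult.assoc[of _ "fact _"] fact_pure_diagram_cone[OF assms(1)]
      by (simp add: atLeast0AtMost sum_divide_distrib)
    also have "\<dots> = of_nat (B i j)"
      using assms(1) unfolding cone_coefficient_sum_Suc assms(7)
      by (simp add: Suc betti)
    finally show ?thesis by (simp add: quot)
  qed
qed

end
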